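(* Let $0<q<1$ and $0<s\le1$. With the modular Fredholm module of the Podleś sphere $\mathcal{A}(S^2_{q,s})$ given by $\mathcal{H},\pi,F,\gamma,K$ as in the context, let $$P=\frac1{1+s^2}\begin{pmatrix}1-q^2A & B \\ B^* & A+s^2\end{pmatrix}\in M_2\big(\mathcal{A}(S^2_{q,s})\big).$$ Then the pairing of the Chern character of $F$ with the equivariant $K_0$-class $[P]$ equals $q$, i.e. $\mathrm{Ch}_2(P,P,P)=q$.
   Context: $\mathcal{A}(S^2_{q,s})$ is the universal unital $*$-algebra generated by $A=A^*$, $B$, $B^*$ with relations $B^*B+(A-1)(A+s^2)=0$, $BB^*+(q^2A-1)(q^2A+s^2)=0$, $AB=q^{-2}BA$. Representations on $\ell^2(\mathbb{N})$ with orthonormal basis $\{e_k\}_{k\ge0}$: $\pi_+(B)e_k=\sqrt{1-q^{2k}}\sqrt{s^2+q^{2k}}\,e_{k-1}$, $\pi_+(A)e_k=q^{2k}e_k$; $\pi_-(B)e_k=s\sqrt{1-q^{2k}}\sqrt{1+s^2q^{2k}}\,e_{k-1}$, $\pi_-(A)e_k=-s^2q^{2k}e_k$. On $\mathcal{H}=\ell^2(\mathbb{N})\oplus\ell^2(\mathbb{N})$: $\pi=\pi_+\oplus\pi_-$ (elements of the algebra are identified with their images), $\gamma=\begin{pmatrix}1&0\\0&-1\end{pmatrix}$, $F=\begin{pmatrix}0&1\\1&0\end{pmatrix}$, and $Ke_{k,\pm}=q^{-2k}e_{k,\pm}$. $P$ is a projection commuting with $K\otimes\Delta$ on $\mathcal{H}\otimes\mathbb{C}^2$,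 where $\Delta=\begin{pmatrix}q^{-1}&0\\0&q\end{pmatrix}$. The Chern character of the module is $\mathrm{Ch}_2(a_0,a_1,a_2)=\lambda_2\tfrac12\mathrm{Tr}(K\gamma F[F,a_0][F,a_1][F,a_2])$ with $\lambda_2=-1$, and its pairing with $[P]$ is its extension to $P$, using $F\otimes1$, $\gamma\otimes1$ and the modular operator $K\otimes\Delta$: $$\mathrm{Ch}_2(P,P,P)=-\tfrac12\,\mathrm{Tr}_{\mathcal{H}\otimes\mathbb{C}^2}\big((K\otimes\Delta)(\gamma F\otimes1)[F\otimes1,P]^3\big).$$ *)

theory Defs
  imports
    "HOL-Analysis.Infinite_Sum"
    "HOL-Analysis.Finite_Cartesian_Product"
    "HOL-Library.Poly_Mapping"
    "HOL-Algebra.QuotRing"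
begin

section \<open>The Hilbert spaces of square-summable families\<close>

typedef 'i ell2 = "{f :: 'i \<Rightarrow> complex. (\<lambda>i. (cmod (f i))\<^sup>2) summable_on UNIV}"
  morphisms coord Abs_ell2
  by (rule exI[of _ "\<lambda>_. 0"]) simp

setup_lifting type_definition_ell2

lemma summable_sq_add:
  fixes f g :: "'i \<Rightarrow> complex"
  assumes "(\<lambda>i. (cmod (f i))\<^sup>2) summable_on UNIV" "(\<lambda>i. (cmod (g i))\<^sup>2) summable_on UNIV"
  shows "(\<lambda>i. (cmod (f i + g i))\<^sup>2) summable_on UNIV"
proof (rule summable_on_comparison_test)
  show "(\<lambda>i. 2 * (cmod (f i))\<^sup>2 + 2 * (cmod (g i))\<^sup>2) summable_on UNIV"
    by (intro summable_on_add summable_on_cmult_right assms)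
  fix i
  have "(cmod (f i + g i))\<^sup>2 \<le> (cmod (f i) + cmod (g i))\<^sup>2"
    by (intro power_mono norm_triangle_ineq) auto
  also have "\<dots> \<le> 2 * (cmod (f i))\<^sup>2 + 2 * (cmod (g i))\<^sup>2"
    using sum_squares_bound[of "cmod (f i)" "cmod (g i)"] by (simp add: power2_sum)
  finally show "(cmod (f i + g i))\<^sup>2 \<le> 2 * (cmod (f i))\<^sup>2 + 2 * (cmod (g i))\<^sup>2" .
qed auto

lemma summable_sq_scale:
  fixes f :: "'i \<Rightarrow> complex"
  assumes "(\<lambda>i. (cmod (f i))\<^sup>2) summable_on UNIV"
  shows "(\<lambda>i. (cmod (c * f i))\<^sup>2) summable_on UNIV"
  using summable_on_cmult_right[OF assms, of "(cmod c)\<^sup>2"]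
  by (simp add: norm_mult power_mult_distrib)

instantiation ell2 :: (type) ab_group_add
begin

lift_definition zero_ell2 :: "'a ell2" is "\<lambda>_. 0" by simp
lift_definition plus_ell2 :: "'a ell2 \<Rightarrow> 'a ell2 \<Rightarrow> 'a ell2" is "\<lambda>f g i. f i + g i"
  by (rule summable_sq_add)
lift_definition uminus_ell2 :: "'a ell2 \<Rightarrow> 'a ell2" is "\<lambda>f i. - f i" by simp
lift_definition minus_ell2 :: "'a ell2 \<Rightarrow> 'a ell2 \<Rightarrow> 'a ell2" is "\<lambda>f g i. f i - g i"
  using summable_sq_add[of _ "\<lambda>i. - _ i"] by fastforce

instance by standard (transfer; auto simp: fun_eq_iff)+

end

lift_definition scaleC_ell2 :: "complex \<Rightarrow> 'i ell2 \<Rightarrow> 'i ell2"  (infixr \<open>*\<^sub>c\<close> 75)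
  is "\<lambda>c f i. c * f i"
  by (rule summable_sq_scale)

lift_definition ket :: "'i \<Rightarrow> 'i ell2" is "\<lambda>k i. if i = k then 1 else 0"
proof -
  fix k :: 'i
  show "(\<lambda>i. (cmod (if i = k then 1 else 0))\<^sup>2) summable_on UNIV"
    by (rule finite_nonzero_values_imp_summable_on, rule finite_subset[of _ "{k}"]) auto
qed

definition cinner :: "'i ell2 \<Rightarrow> 'i ell2 \<Rightarrow> complex" where
  "cinner u v = (\<Sum>\<^sub>\<infinity>i. cnj (coord u i) * coord v i)"

definition ell2_norm :: "'i ell2 \<Rightarrow> real" where
  "ell2_norm v = sqrt (\<Sum>\<^sub>\<infinity>i. (cmod (coord v i))\<^sup>2)"

section \<open>Operators\<close>

type_synonym 'i op = "'i ell2 \<Rightarrow> 'i ell2"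

definition bounded_op :: "'i op \<Rightarrow> bool" where
  "bounded_op T \<longleftrightarrow>
     (\<forall>u v. T (u + v) = T u + T v) \<and> (\<forall>c v. T (c *\<^sub>c v) = c *\<^sub>c T v) \<and>
     (\<exists>C. \<forall>v. ell2_norm (T v) \<le> C * ell2_norm v)"

definition adjoint_op :: "'i op \<Rightarrow> 'i op" where
  "adjoint_op T = (THE S. bounded_op S \<and> (\<forall>u v. cinner (S u) v = cinner u (T v)))"

definition basis_op :: "('i \<Rightarrow> 'i ell2) \<Rightarrow> 'i op" where
  "basis_op f = (THE T. bounded_op T \<and> (\<forall>i. T (ket i) = f i))"

text \<open>
  The definite description in \<open>basis_op\<close> is justified by uniqueness (\<open>basis_op_eqI\<close>) and, for
  weighted shifts, by existence (\<open>weighted_shift_op\<close>).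
\<close>

lemma coord_sum: "coord (\<Sum>x\<in>F. f x) i = (\<Sum>x\<in>F. coord (f x) i)"
  by (induction F rule: infinite_finite_induct) (auto simp: zero_ell2.rep_eq plus_ell2.rep_eq)

lemma bounded_op_sum:
  assumes "bounded_op T"
  shows "T (\<Sum>x\<in>F. c x *\<^sub>c f x) = (\<Sum>x\<in>F. c x *\<^sub>c T (f x))"
proof -
  have add: "T (u + v) = T u + T v" and scale: "T (c *\<^sub>c v) = c *\<^sub>c T v" for u v c
    using assms by (auto simp: bounded_op_def)
  have "T 0 = 0" using add[of 0 0] by simp
  then show ?thesis
    by (induction F rule: infinite_finite_induct) (auto simp: add scale)
qed

lemma ell2_norm_nonneg: "0 \<le> ell2_norm v"
  by (auto simp: ell2_norm_def intro!: infsum_nonneg)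

lemma summable_coord: "(\<lambda>i. (cmod (coord v i))\<^sup>2) summable_on UNIV"
  using coord[of v] by simp

lemma ell2_norm_eq_0: 
  assumes "ell2_norm v = 0"
  shows "v = 0"
proof -
  have "(\<Sum>\<^sub>\<infinity>i. (cmod (coord v i))\<^sup>2) = 0"
    using assms by (simp add: ell2_norm_def)
  then have "(cmod (coord v i))\<^sup>2 = 0" for i
    using nonneg_infsum_le_0D[of "\<lambda>i. (cmod (coord v i))\<^sup>2" UNIV i] summable_coord[of v]
    by auto
  then show ?thesis by (simp add: coord_inject[symmetric] zero_ell2.rep_eq fun_eq_iff)
qed

lemma bounded_op_eqI:
  fixes S T :: "'i op"
  assumes S: "bounded_op S" and T: "bounded_op T" and eq: "\<And>i. S (ket i) = T (ket i)"
  shows "S = T"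
proof
  fix v :: "'i ell2"
  obtain C D where C: "\<And>v. ell2_norm (S v) \<le> C * ell2_norm v"
    and D: "\<And>v. ell2_norm (T v) \<le> D * ell2_norm v"
    using S T unfolding bounded_op_def by blast
  let ?N = "\<lambda>i. (cmod (coord v i))\<^sup>2"
  define E where "E = 2 * C\<^sup>2 + 2 * D\<^sup>2"
  have sq: "(ell2_norm u)\<^sup>2 = (\<Sum>\<^sub>\<infinity>i. (cmod (coord u i))\<^sup>2)" for u :: "'i ell2"
    by (simp add: ell2_norm_def infsum_nonneg)
  have key: "(ell2_norm (S v - T v))\<^sup>2 \<le> E * (infsum ?N UNIV - sum ?N F)" if F: "finite F" for F
  proof -
    define p where "p = (\<Sum>i\<in>F. coord v i *\<^sub>c ket i)"
    define r where "r = v - p"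
    have p: "coord p i = (if i \<in> F then coord v i else 0)" for i
      using F by (simp add: p_def coord_sum scaleC_ell2.rep_eq ket.rep_eq if_distrib cong: if_cong)
    have "S p = T p" by (simp add: p_def bounded_op_sum S T eq)
    moreover have "S v = S p + S r" "T v = T p + T r"
      using S T unfolding bounded_op_def r_def by (metis add_diff_cancel_left' diff_add_cancel add.commute)+
    ultimately have d: "S v - T v = S r - T r" by simp
    have "(ell2_norm r)\<^sup>2 = (\<Sum>\<^sub>\<infinity>i\<in>UNIV - F. ?N i)"
      unfolding sq by (rule infsum_cong_neutral) (auto simp: r_def p minus_ell2.rep_eq)
    also have "\<dots> = infsum ?N UNIV - sum ?N F"
      using F by (subst infsum_Diff) (auto intro: summable_coord)
    finally have nr: "(ell2_norm r)\<^sup>2 = infsum ?N UNIV - sum ?N F" .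
    have "(ell2_norm (S r - T r))\<^sup>2
        \<le> (\<Sum>\<^sub>\<infinity>i. 2 * (cmod (coord (S r) i))\<^sup>2 + 2 * (cmod (coord (T r) i))\<^sup>2)"
      unfolding sq
    proof (rule infsum_mono)
      show "(\<lambda>i. 2 * (cmod (coord (S r) i))\<^sup>2 + 2 * (cmod (coord (T r) i))\<^sup>2) summable_on UNIV"
        by (intro summable_on_add summable_on_cmult_right summable_coord)
      fix i
      have "(cmod (coord (S r) i - coord (T r) i))\<^sup>2
          \<le> (cmod (coord (S r) i) + cmod (coord (T r) i))\<^sup>2"
        by (intro power_mono norm_triangle_ineq4) auto
      then show "(cmod (coord (S r - T r) i))\<^sup>2
          \<le> 2 * (cmod (coord (S r) i))\<^sup>2 + 2 * (cmod (coord (T r) i))\<^sup>2"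
        using sum_squares_bound[of "cmod (coord (S r) i)" "cmod (coord (T r) i)"]
        by (simp add: power2_sum minus_ell2.rep_eq)
    qed (rule summable_coord)
    also have "\<dots> = 2 * (ell2_norm (S r))\<^sup>2 + 2 * (ell2_norm (T r))\<^sup>2"
      unfolding sq
      by (subst infsum_add) (auto intro!: summable_on_cmult_right summable_coord simp: infsum_cmult_right')
    also have "\<dots> \<le> 2 * (C * ell2_norm r)\<^sup>2 + 2 * (D * ell2_norm r)\<^sup>2"
      by (intro add_mono mult_left_mono power_mono C D ell2_norm_nonneg) auto
    also have "\<dots> = E * (ell2_norm r)\<^sup>2" by (simp add: E_def power_mult_distrib algebra_simps)
    finally show ?thesis by (simp add: d nr)
  qed
  have "((\<lambda>F. E * (infsum ?N UNIV - sum ?N F)) \<longlongrightarrow> E * (infsum ?N UNIV - infsum ?N UNIV))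
      (finite_subsets_at_top UNIV)"
    by (intro tendsto_intros infsum_tendsto summable_coord)
  then have "(ell2_norm (S v - T v))\<^sup>2 \<le> E * (infsum ?N UNIV - infsum ?N UNIV)"
    by (rule tendsto_lowerbound) (auto intro!: eventually_finite_subsets_at_top_weakI key)
  then have "ell2_norm (S v - T v) = 0" by simp
  then show "S v = T v" using ell2_norm_eq_0 by fastforce
qed

lemma basis_op_eqI:
  assumes "bounded_op T" "\<And>i. T (ket i) = f i"
  shows "basis_op f = T"
  unfolding basis_op_def
  by (rule the_equality) (use assms in \<open>auto intro: bounded_op_eqI\<close>)

lemma weighted_shift_op:
  fixes w :: "'i \<Rightarrow> complex" and h :: "'i \<Rightarrow> 'i"
  assumes w: "\<And>i. cmod (w i) \<le> C" and h: "inj_on h {i. w i \<noteq> 0}"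
  shows "bounded_op (basis_op (\<lambda>i. w i *\<^sub>c ket (h i)))"
    and "basis_op (\<lambda>i. w i *\<^sub>c ket (h i)) (ket k) = w k *\<^sub>c ket (h k)"
proof -
  define I where "I = {i. w i \<noteq> 0}"
  define f where "f v j = (if j \<in> h ` I then w (inv_into I h j) * coord v (inv_into I h j) else 0)"
    for v j
  define T where "T v = Abs_ell2 (f v)" for v
  have inj: "inj_on h I" using h by (simp add: I_def)
  have inv: "inv_into I h (h i) = i" if "i \<in> I" for i using inv_into_f_f[OF inj that] .
  have C0: "0 \<le> C" using w[of undefined] norm_ge_zero order_trans by blast
  have le: "(cmod (w i * coord v i))\<^sup>2 \<le> C\<^sup>2 * (cmod (coord v i))\<^sup>2" for v i
    using w[of i] by (simp add: norm_mult power_mult_distrib mult_right_mono power_mono)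
  have sI: "(\<lambda>i. (cmod (w i * coord v i))\<^sup>2) summable_on I" for v
    by (rule summable_on_comparison_test[of "\<lambda>i. C\<^sup>2 * (cmod (coord v i))\<^sup>2"])
       (auto intro!: summable_on_cmult_right summable_on_subset_banach[OF summable_coord] le)
  have re: "((\<lambda>j. (cmod (f v j))\<^sup>2) \<circ> h) i = (cmod (w i * coord v i))\<^sup>2" if "i \<in> I" for v i
    using that by (simp add: f_def inv)
  have "(\<lambda>j. (cmod (f v j))\<^sup>2) summable_on h ` I" for v
    using sI[of v] by (subst summable_on_reindex[OF inj], subst summable_on_cong[OF re]) auto
  then have sf: "(\<lambda>j. (cmod (f v j))\<^sup>2) summable_on UNIV" for v
    by (rule summable_on_cong_neutral[THEN iffD1, rotated -1]) (auto simp: f_def)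
  have cT: "coord (T v) = f v" for v
    unfolding T_def by (rule Abs_ell2_inverse) (simp add: sf)
  have bound: "ell2_norm (T v) \<le> C * ell2_norm v" for v
  proof -
    have "(\<Sum>\<^sub>\<infinity>j. (cmod (f v j))\<^sup>2) = (\<Sum>\<^sub>\<infinity>j\<in>h ` I. (cmod (f v j))\<^sup>2)"
      by (rule infsum_cong_neutral) (auto simp: f_def)
    also have "\<dots> = (\<Sum>\<^sub>\<infinity>i\<in>I. (cmod (w i * coord v i))\<^sup>2)"
      by (subst infsum_reindex[OF inj], rule infsum_cong, rule re)
    also have "\<dots> \<le> (\<Sum>\<^sub>\<infinity>i. C\<^sup>2 * (cmod (coord v i))\<^sup>2)"
      by (rule infsum_mono_neutral)
         (auto intro!: sI summable_on_cmult_right summable_coord le)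
    also have "\<dots> = C\<^sup>2 * (\<Sum>\<^sub>\<infinity>i. (cmod (coord v i))\<^sup>2)" by (rule infsum_cmult_right')
    finally have "ell2_norm (T v) \<le> sqrt (C\<^sup>2 * (\<Sum>\<^sub>\<infinity>i. (cmod (coord v i))\<^sup>2))"
      by (simp add: ell2_norm_def cT)
    then show ?thesis using C0 by (simp add: ell2_norm_def real_sqrt_mult)
  qed
  have T: "bounded_op T"
    unfolding bounded_op_def
    using bound by (auto simp: coord_inject[symmetric] cT f_def fun_eq_iff plus_ell2.rep_eq
        scaleC_ell2.rep_eq algebra_simps)
  have Tk: "T (ket i) = w i *\<^sub>c ket (h i)" for i
  proof -
    have "f (ket i) j = w i * coord (ket (h i)) j" for j
      using inv inj by (cases "i \<in> I") (auto simp: f_def ket.rep_eq I_def)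
    then show ?thesis by (simp add: coord_inject[symmetric] cT scaleC_ell2.rep_eq fun_eq_iff)
  qed
  have "basis_op (\<lambda>i. w i *\<^sub>c ket (h i)) = T" by (rule basis_op_eqI[OF T Tk])
  then show "bounded_op (basis_op (\<lambda>i. w i *\<^sub>c ket (h i)))"
    and "basis_op (\<lambda>i. w i *\<^sub>c ket (h i)) (ket k) = w k *\<^sub>c ket (h k)"
    using T Tk by auto
qed

definition comm_op :: "'i op \<Rightarrow> 'i op \<Rightarrow> 'i op" where
  "comm_op S T = (\<lambda>v. S (T v) - T (S v))"

definition positive_op :: "'i op \<Rightarrow> bool" where
  "positive_op R \<longleftrightarrow> bounded_op R \<and> (\<forall>v. cinner v (R v) \<in> \<real> \<and> 0 \<le> Re (cinner v (R v)))"

text \<open>The operator \<open>R\<close> below is the absolute value of \<open>T\<close>.\<close>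

definition trace_class :: "'i op \<Rightarrow> bool" where
  "trace_class T \<longleftrightarrow> bounded_op T \<and>
     (\<exists>R. positive_op R \<and> R \<circ> R = adjoint_op T \<circ> T \<and>
          (\<lambda>i. Re (cinner (ket i) (R (ket i)))) summable_on UNIV)"

definition trace_op :: "'i op \<Rightarrow> complex" where
  "trace_op T = (\<Sum>\<^sub>\<infinity>i. cinner (ket i) (T (ket i)))"

text \<open>
  The self-adjoint, in general unbounded, diagonal operator with real eigenvalues \<open>d\<close> on its
  maximal domain. Outside \<open>diag_dom d\<close> the value of \<open>diag_op d\<close> is meaningless.
\<close>

definition diag_dom :: "('i \<Rightarrow> real) \<Rightarrow> 'i ell2 set" where
  "diag_dom d = {v. (\<lambda>i. (cmod (of_real (d i) * coord v i))\<^sup>2) summable_on UNIV}"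

definition diag_op :: "('i \<Rightarrow> real) \<Rightarrow> 'i op" where
  "diag_op d v = Abs_ell2 (\<lambda>i. of_real (d i) * coord v i)"

definition commutes_with_diag :: "('i \<Rightarrow> real) \<Rightarrow> 'i op \<Rightarrow> bool" where
  "commutes_with_diag d T \<longleftrightarrow>
     (\<forall>v\<in>diag_dom d. T v \<in> diag_dom d \<and> diag_op d (T v) = T (diag_op d v))"

section \<open>Block operators\<close>

text \<open>
  The space \<open>('i \<times> 'n) ell2\<close> plays the role of the direct sum of copies of \<open>'i ell2\<close> indexed
  by \<open>'n\<close>, equivalently of the tensor product of \<open>'i ell2\<close> with \<open>\<complex>\<^sup>n\<close>. The vector \<open>slice j v\<close>
  is the \<open>j\<close>-th component of \<open>v\<close>, and \<open>block_op M\<close> acts by matrix times column vector.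
\<close>

lift_definition slice :: "'n \<Rightarrow> ('i \<times> 'n) ell2 \<Rightarrow> 'i ell2" is "\<lambda>j f i. f (i, j)"
proof -
  fix j :: 'n and f :: "'i \<times> 'n \<Rightarrow> complex"
  assume "(\<lambda>p. (cmod (f p))\<^sup>2) summable_on UNIV"
  then have "(\<lambda>p. (cmod (f p))\<^sup>2) summable_on range (\<lambda>i. (i, j))"
    by (rule summable_on_subset_banach) auto
  then show "(\<lambda>i. (cmod (f (i, j)))\<^sup>2) summable_on UNIV"
    by (subst (asm) summable_on_reindex) (auto simp: inj_on_def o_def)
qed

lift_definition embed :: "'n \<Rightarrow> 'i ell2 \<Rightarrow> ('i \<times> 'n) ell2"
  is "\<lambda>j f p. if snd p = j then f (fst p) else 0"
proof -
  fix j :: 'n and f :: "'i \<Rightarrow> complex"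
  assume "(\<lambda>i. (cmod (f i))\<^sup>2) summable_on UNIV"
  then have "(\<lambda>p. (cmod (f (fst p)))\<^sup>2) summable_on range (\<lambda>i. (i, j))"
    by (subst summable_on_reindex) (auto simp: inj_on_def o_def)
  then show "(\<lambda>p. (cmod (if snd p = j then f (fst p) else 0))\<^sup>2) summable_on UNIV"
    by (rule summable_on_cong_neutral[THEN iffD1, rotated -1]) auto
qed

definition block_op :: "'i op ^ 'n ^ 'n \<Rightarrow> ('i \<times> 'n) op" where
  "block_op M v = (\<Sum>i\<in>UNIV. embed i (\<Sum>j\<in>UNIV. (M $ i $ j) (slice j v)))"

definition mat2 :: "'a \<Rightarrow> 'a \<Rightarrow> 'a \<Rightarrow> 'a \<Rightarrow> 'a ^ 2 ^ 2" where
  "mat2 a b c d =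
     (\<chi> i j. if i = 1 then (if j = 1 then a else b) else (if j = 1 then c else d))"

definition tensor_id :: "'i op \<Rightarrow> ('i \<times> 2) op" where
  "tensor_id T = block_op (mat2 T (\<lambda>_. 0) (\<lambda>_. 0) T)"

section \<open>The Podles sphere as a universal *-algebra\<close>

text \<open>
  The free unital complex *-algebra on a self-adjoint generator \<open>A\<close> and a generator \<open>B\<close> is the
  monoid algebra over the words in three letters.
\<close>

datatype podles_gen = GenA | GenB | GenBstar

datatype podles_word = Word (letters: "podles_gen list")

instantiation podles_word :: monoid_add
begin

definition zero_podles_word :: podles_word where "0 = Word []"

definition plus_podles_word :: "podles_word \<Rightarrow> podles_word \<Rightarrow> podles_word" where
  "u + v = Word (letters u @ letters v)"

instance by standard (auto simp: zero_podles_word_def plus_podles_word_def)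

end

type_synonym podles_free = "podles_word \<Rightarrow>\<^sub>0 complex"

definition scal :: "real \<Rightarrow> podles_free" where
  "scal c = Poly_Mapping.single 0 (of_real c)"

definition gen :: "podles_gen \<Rightarrow> podles_free" where
  "gen g = Poly_Mapping.single (Word [g]) 1"

fun gen_star :: "podles_gen \<Rightarrow> podles_gen" where
  "gen_star GenA = GenA"
| "gen_star GenB = GenBstar"
| "gen_star GenBstar = GenB"

definition free_star :: "podles_free \<Rightarrow> podles_free" where
  "free_star x = (\<Sum>w\<in>Poly_Mapping.keys x.
     Poly_Mapping.single (Word (rev (map gen_star (letters w)))) (cnj (Poly_Mapping.lookup x w)))"

definition free_ring :: "podles_free ring" where
  "free_ring = \<lparr>carrier = UNIV, mult = (*), one = 1, zero = 0, add = (+)\<rparr>"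

definition podles_relators :: "real \<Rightarrow> real \<Rightarrow> podles_free set" where
  "podles_relators q s =
     {gen GenBstar * gen GenB + (gen GenA - 1) * (gen GenA + scal (s\<^sup>2)),
      gen GenB * gen GenBstar
        + (scal (q\<^sup>2) * gen GenA - 1) * (scal (q\<^sup>2) * gen GenA + scal (s\<^sup>2)),
      gen GenA * gen GenB - scal (inverse (q\<^sup>2)) * gen GenB * gen GenA}"

text \<open>
  The two-sided ideal is automatically a complex subspace, since the scalars are elements of
  the ring, and it is closed under the involution because of the adjoined images under it.
\<close>

definition podles_ideal :: "real \<Rightarrow> real \<Rightarrow> podles_free set" where
  "podles_ideal q s =
     genideal free_ring (podles_relators q s \<union> free_star ` podles_relators q s)"

definition podles_algebra :: "real \<Rightarrow> real \<Rightarrow> podles_free set ring" where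
  "podles_algebra q s = free_ring Quot podles_ideal q s"

definition podles_class :: "real \<Rightarrow> real \<Rightarrow> podles_free \<Rightarrow> podles_free set" where
  "podles_class q s x = podles_ideal q s +>\<^bsub>free_ring\<^esub> x"

definition podles_star :: "podles_free set \<Rightarrow> podles_free set" where
  "podles_star X = free_star ` X"

definition mat_mult_ring :: "('a, 'b) ring_scheme \<Rightarrow> 'a ^ 2 ^ 2 \<Rightarrow> 'a ^ 2 ^ 2 \<Rightarrow> 'a ^ 2 ^ 2" where
  "mat_mult_ring R M N = (\<chi> i j. \<Oplus>\<^bsub>R\<^esub>k\<in>UNIV. M $ i $ k \<otimes>\<^bsub>R\<^esub> N $ k $ j)"

definition podles_is_projection :: "real \<Rightarrow> real \<Rightarrow> podles_free set ^ 2 ^ 2 \<Rightarrow> bool" where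
  "podles_is_projection q s P \<longleftrightarrow>
     (\<forall>i j. P $ i $ j \<in> carrier (podles_algebra q s)) \<and>
     mat_mult_ring (podles_algebra q s) P P = P \<and>
     (\<chi> i j. podles_star (P $ j $ i)) = P"

definition podles_P :: "real \<Rightarrow> real \<Rightarrow> podles_free set ^ 2 ^ 2" where
  "podles_P q s = (let c = scal (1 / (1 + s\<^sup>2)); cl = podles_class q s in
     mat2 (cl (c * (1 - scal (q\<^sup>2) * gen GenA))) (cl (c * gen GenB))
          (cl (c * gen GenBstar)) (cl (c * (gen GenA + scal (s\<^sup>2)))))"

section \<open>Representations\<close>

text \<open>Evaluation of a free polynomial, where the first letter of a word acts last.\<close>

definition free_eval :: "(podles_gen \<Rightarrow> 'i op) \<Rightarrow> podles_free \<Rightarrow> 'i op" where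
  "free_eval g x v =
     (\<Sum>w\<in>Poly_Mapping.keys x. Poly_Mapping.lookup x w *\<^sub>c foldr g (letters w) v)"

fun gen_ops :: "'i op \<Rightarrow> 'i op \<Rightarrow> podles_gen \<Rightarrow> 'i op" where
  "gen_ops a b GenA = a"
| "gen_ops a b GenB = b"
| "gen_ops a b GenBstar = adjoint_op b"

text \<open>
  The operator \<open>rep_of a b X\<close> is the common value on the coset \<open>X\<close> of the *-homomorphism sending
  the generators to \<open>a\<close> and \<open>b\<close>.
\<close>

definition rep_of :: "'i op \<Rightarrow> 'i op \<Rightarrow> podles_free set \<Rightarrow> 'i op" where
  "rep_of a b X = the_elem (free_eval (gen_ops a b) ` X)"

text \<open>For \<open>k = 0\<close> the coefficient of \<open>ket (k - 1)\<close> vanishes.\<close>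

definition A_plus :: "real \<Rightarrow> nat op" where
  "A_plus q = basis_op (\<lambda>k. of_real (q ^ (2 * k)) *\<^sub>c ket k)"

definition B_plus :: "real \<Rightarrow> real \<Rightarrow> nat op" where
  "B_plus q s = basis_op (\<lambda>k.
     of_real (sqrt (1 - q ^ (2 * k)) * sqrt (s\<^sup>2 + q ^ (2 * k))) *\<^sub>c ket (k - 1))"

definition A_minus :: "real \<Rightarrow> real \<Rightarrow> nat op" where
  "A_minus q s = basis_op (\<lambda>k. of_real (- s\<^sup>2 * q ^ (2 * k)) *\<^sub>c ket k)"

definition B_minus :: "real \<Rightarrow> real \<Rightarrow> nat op" where
  "B_minus q s = basis_op (\<lambda>k.
     of_real (s * sqrt (1 - q ^ (2 * k)) * sqrt (1 + s\<^sup>2 * q ^ (2 * k))) *\<^sub>c ket (k - 1))"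

definition pi_plus :: "real \<Rightarrow> real \<Rightarrow> podles_free set \<Rightarrow> nat op" where
  "pi_plus q s = rep_of (A_plus q) (B_plus q s)"

definition pi_minus :: "real \<Rightarrow> real \<Rightarrow> podles_free set \<Rightarrow> nat op" where
  "pi_minus q s = rep_of (A_minus q s) (B_minus q s)"

text \<open>In \<open>(nat \<times> 2) ell2\<close> the vectors \<open>e\<^sub>k\<^sub>,\<^sub>+\<close> and \<open>e\<^sub>k\<^sub>,\<^sub>-\<close> are \<open>ket (k, 1)\<close> and \<open>ket (k, 2)\<close>.\<close>

definition podles_rep :: "real \<Rightarrow> real \<Rightarrow> podles_free set \<Rightarrow> (nat \<times> 2) op" where
  "podles_rep q s X = block_op (mat2 (pi_plus q s X) (\<lambda>_. 0) (\<lambda>_. 0) (pi_minus q s X))"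

definition podles_rep_mat :: "real \<Rightarrow> real \<Rightarrow> podles_free set ^ 2 ^ 2 \<Rightarrow> ((nat \<times> 2) \<times> 2) op" where
  "podles_rep_mat q s P = block_op (\<chi> i j. podles_rep q s (P $ i $ j))"

section \<open>The modular Fredholm module and its Chern character\<close>

definition gamma_op :: "(nat \<times> 2) op" where
  "gamma_op = block_op (mat2 (\<lambda>v. v) (\<lambda>_. 0) (\<lambda>_. 0) (\<lambda>v. - v))"

definition F_op :: "(nat \<times> 2) op" where
  "F_op = block_op (mat2 (\<lambda>_. 0) (\<lambda>v. v) (\<lambda>v. v) (\<lambda>_. 0))"

definition K_eig :: "real \<Rightarrow> nat \<times> 2 \<Rightarrow> real" where
  "K_eig q = (\<lambda>(k, _). inverse (q ^ (2 * k)))"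

text \<open>Eigenvalues of \<open>K \<otimes> \<Delta>\<close>.\<close>

definition K_Delta_eig :: "real \<Rightarrow> (nat \<times> 2) \<times> 2 \<Rightarrow> real" where
  "K_Delta_eig q = (\<lambda>(p, j). K_eig q p * (if j = 1 then inverse q else q))"

text \<open>
  The operator under the trace is \<open>diag_op d \<circ> chern_bounded_part g F a0 a1 a2\<close> for the modular
  operator \<open>diag_op d\<close>; the trace is taken of an everywhere defined trace class operator if
  \<open>chern2_well_defined\<close> holds.
\<close>

definition chern_bounded_part :: "'i op \<Rightarrow> 'i op \<Rightarrow> 'i op \<Rightarrow> 'i op \<Rightarrow> 'i op \<Rightarrow> 'i op" where
  "chern_bounded_part g F a0 a1 a2 = g \<circ> F \<circ> comm_op F a0 \<circ> comm_op F a1 \<circ> comm_op F a2"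

definition chern2_well_defined ::
  "('i \<Rightarrow> real) \<Rightarrow> 'i op \<Rightarrow> 'i op \<Rightarrow> 'i op \<Rightarrow> 'i op \<Rightarrow> 'i op \<Rightarrow> bool" where
  "chern2_well_defined d g F a0 a1 a2 \<longleftrightarrow>
     range (chern_bounded_part g F a0 a1 a2) \<subseteq> diag_dom d \<and>
     trace_class (diag_op d \<circ> chern_bounded_part g F a0 a1 a2)"

definition chern_lambda2 :: complex where "chern_lambda2 = -1"

definition chern2 ::
  "('i \<Rightarrow> real) \<Rightarrow> 'i op \<Rightarrow> 'i op \<Rightarrow> 'i op \<Rightarrow> 'i op \<Rightarrow> 'i op \<Rightarrow> complex" where
  "chern2 d g F a0 a1 a2 =
     chern_lambda2 * (1 / 2) * trace_op (diag_op d \<circ> chern_bounded_part g F a0 a1 a2)"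

end

theory Submission
  imports Defs "HOL-Analysis.Cartesian_Space" "HOL-Analysis.Elementary_Normed_Spaces"
begin

text \<open>
  Put \<open>D = P\<^sub>+ - P\<^sub>-\<close> for the images of \<open>P\<close> under the two representations. Then
  \<open>\<gamma> F [F, P]\<^sup>3 = - (D\<^sup>3 \<oplus> D\<^sup>3)\<close>, so the pairing is the trace of \<open>(K \<otimes> \<Delta>) D\<^sup>3\<close>.
  The difference of the two values of \<open>A\<close> on the \<open>k\<close>-th basis vector is \<open>(1 + s\<^sup>2) q\<^sup>2\<^sup>k\<close>, hence \<open>D\<close>
  preserves the span of the basis vectors \<open>(n - 1, 1)\<close> and \<open>(n, 2)\<close>, where it is the symmetric
  matrix with diagonal \<open>- q\<^sup>2\<^sup>n, q\<^sup>2\<^sup>n\<close> and some off-diagonal entry \<open>b n = O(q\<^sup>2\<^sup>n)\<close>. Its square is the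
  scalar \<open>c n = q\<^sup>4\<^sup>n + (b n)\<^sup>2\<close>, so \<open>D\<^sup>3 = c n D\<close> is traceless there, and \<open>K \<otimes> \<Delta>\<close> is the scalar
  \<open>q / q\<^sup>2\<^sup>n\<close>. Only the one-dimensional block \<open>n = 0\<close> contributes, with the value \<open>q\<close>.
\<close>

section \<open>The involution and the defining ideal\<close>

text \<open>A finitely supported function is the finite sum of its monomials, so additive identities
  in the free algebra need only be checked on scalar multiples of words.\<close>

lemma poly_mapping_single_induct [case_names single add]:
  assumes "\<And>w c. Q (Poly_Mapping.single w c)" and "\<And>x y. Q x \<Longrightarrow> Q y \<Longrightarrow> Q (x + y)"
  shows "Q (x :: 'a \<Rightarrow>\<^sub>0 'b::comm_monoid_add)"
proof -
  have "Q (\<Sum>w\<in>F. Poly_Mapping.single w (Poly_Mapping.lookup x w))" if "finite F" for F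
    using that
  proof (induction F)
    case empty
    show ?case using assms(1)[of undefined 0] by simp
  qed (simp add: assms)
  moreover have "(\<Sum>w\<in>Poly_Mapping.keys x. Poly_Mapping.single w (Poly_Mapping.lookup x w)) = x"
  proof (rule poly_mapping_eqI)
    fix k
    show "Poly_Mapping.lookup (\<Sum>w\<in>Poly_Mapping.keys x. Poly_Mapping.single w (Poly_Mapping.lookup x w)) k
        = Poly_Mapping.lookup x k"
      by (simp add: lookup_sum lookup_single when_def in_keys_iff)
  qed
  ultimately show ?thesis by (metis finite_keys)
qed

lemma free_star_single:
  "free_star (Poly_Mapping.single w c) = Poly_Mapping.single (Word (rev (map gen_star (letters w)))) (cnj c)"
  by (simp add: free_star_def)

lemma free_star_add: "free_star (x + y) = free_star x + free_star y"
  unfolding free_star_def by (rule setsum_keys_plus_distrib) (auto simp: single_add)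

lemma free_star_zero: "free_star 0 = 0"
  by (simp add: free_star_def)

lemma free_star_uminus: "free_star (- x) = - free_star x"
  using free_star_add[of x "- x"] free_star_zero by (simp add: minus_unique)

lemma free_star_diff: "free_star (x - y) = free_star x - free_star y"
  using free_star_add[of x "- y"] by (simp add: free_star_uminus)

lemma free_star_mult: "free_star (x * y) = free_star y * free_star x"
proof (induction x rule: poly_mapping_single_induct)
  case (single w c)
  show ?case
    by (induction y rule: poly_mapping_single_induct)
      (auto simp: mult_single free_star_single plus_podles_word_def algebra_simps free_star_add)
qed (simp add: free_star_add algebra_simps)

lemma free_star_scal: "free_star (scal c) = scal c"
  by (simp add: scal_def free_star_single zero_podles_word_def)

lemma free_star_gen: "free_star (gen g) = gen (gen_star g)"
  by (simp add: gen_def free_star_single)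

lemma scal_one: "scal 1 = 1"
  by (simp add: scal_def)

lemma free_star_one: "free_star 1 = 1"
  using free_star_scal[of 1] by (simp add: scal_one)

lemma free_star_free_star: "free_star (free_star x) = x"
proof (induction x rule: poly_mapping_single_induct)
  case (single w c)
  have "gen_star \<circ> gen_star = id"
    by (rule ext) (metis comp_apply gen_star.elims gen_star.simps id_apply)
  then show ?case by (simp add: free_star_single rev_map)
qed (simp add: free_star_add)

lemma scal_add: "scal a + scal b = scal (a + b)"
  by (simp add: scal_def single_add)

lemma scal_mult: "scal a * scal b = scal (a * b)"
  by (simp add: scal_def mult_single)

lemma scal_central: "x * scal a = scal a * x"
  unfolding scal_def
  by (induction x rule: poly_mapping_single_induct) (simp_all add: mult_single algebra_simps)

section \<open>The ideal of relations\<close>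

lemma ring_free_ring: "ring free_ring"
  by (intro ringI abelian_groupI monoidI)
    (auto simp: free_ring_def algebra_simps intro: exI[of _ "- _"])

interpretation free: ring free_ring
  by (rule ring_free_ring)

lemma a_inv_free_ring: "\<ominus>\<^bsub>free_ring\<^esub> x = - x"
  by (rule free.minus_equality) (auto simp: free_ring_def)

text \<open>Two ideals are recognised this way: the preimage of \<open>podles_ideal\<close> under
  the involution and the kernel of an evaluation map. Each contains the generators, hence
  \<open>podles_ideal\<close>.\<close>

lemma ideal_free_ringI:
  assumes "0 \<in> J" "\<And>x y. x \<in> J \<Longrightarrow> y \<in> J \<Longrightarrow> x + y \<in> J" "\<And>x. x \<in> J \<Longrightarrow> - x \<in> J"
    and "\<And>x y. x \<in> J \<Longrightarrow> y * x \<in> J" "\<And>x y. x \<in> J \<Longrightarrow> x * y \<in> J"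
  shows "ideal J free_ring"
proof (rule idealI[OF ring_free_ring])
  show "subgroup J (add_monoid free_ring)"
    by (rule subgroup.intro)
      (use assms a_inv_free_ring in \<open>auto simp: free_ring_def a_inv_def\<close>)
qed (use assms in \<open>auto simp: free_ring_def\<close>)

lemma ideal_podles_ideal: "ideal (podles_ideal q s) free_ring"
  unfolding podles_ideal_def by (rule free.genideal_ideal) (simp add: free_ring_def)

lemma podles_ideal_closed:
  shows "0 \<in> podles_ideal q s"
    and "x \<in> podles_ideal q s \<Longrightarrow> y \<in> podles_ideal q s \<Longrightarrow> x + y \<in> podles_ideal q s"
    and "x \<in> podles_ideal q s \<Longrightarrow> - x \<in> podles_ideal q s"
    and "x \<in> podles_ideal q s \<Longrightarrow> z * x \<in> podles_ideal q s"
    and "x \<in> podles_ideal q s \<Longrightarrow> x * z \<in> podles_ideal q s"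
proof -
  interpret ideal "podles_ideal q s" free_ring by (rule ideal_podles_ideal)
  show "0 \<in> podles_ideal q s" using zero_closed by (simp add: free_ring_def)
  show "x \<in> podles_ideal q s \<Longrightarrow> y \<in> podles_ideal q s \<Longrightarrow> x + y \<in> podles_ideal q s"
    using a_closed by (simp add: free_ring_def)
  show "x \<in> podles_ideal q s \<Longrightarrow> - x \<in> podles_ideal q s"
    using a_inv_closed[of x] by (simp add: a_inv_free_ring)
  show "x \<in> podles_ideal q s \<Longrightarrow> z * x \<in> podles_ideal q s"
    using I_l_closed[of x z] by (simp add: free_ring_def)
  show "x \<in> podles_ideal q s \<Longrightarrow> x * z \<in> podles_ideal q s"
    using I_r_closed[of x z] by (simp add: free_ring_def)
qed

lemma podles_ideal_generators:
  "podles_relators q s \<union> free_star ` podles_relators q s \<subseteq> podles_ideal q s"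
  unfolding podles_ideal_def by (rule free.genideal_self) (simp add: free_ring_def)

text \<open>The preimage of the ideal under \<open>free_star\<close> is an ideal, because the
  involution is additive and exchanges left and right multiples. The set of generators is stable
  under the involution, so minimality applies.\<close>

lemma free_star_podles_ideal:
  assumes "x \<in> podles_ideal q s"
  shows "free_star x \<in> podles_ideal q s"
proof -
  have "ideal {x. free_star x \<in> podles_ideal q s} free_ring"
    by (rule ideal_free_ringI)
      (auto simp: free_star_zero free_star_add free_star_uminus free_star_mult podles_ideal_closed)
  moreover have "podles_relators q s \<union> free_star ` podles_relators q s
      \<subseteq> {x. free_star x \<in> podles_ideal q s}"
    using podles_ideal_generators[of q s] by (auto simp: free_star_free_star)
  ultimately have "podles_ideal q s \<subseteq> {x. free_star x \<in> podles_ideal q s}"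
    unfolding podles_ideal_def by (rule free.genideal_minimal)
  then show ?thesis using assms by blast
qed

section \<open>Cosets and the projection\<close>

lemma podles_class_eq: "podles_class q s x = (\<lambda>i. i + x) ` podles_ideal q s"
  by (auto simp: podles_class_def a_r_coset_def' free_ring_def)

lemma podles_class_eqI:
  assumes "x - y \<in> podles_ideal q s"
  shows "podles_class q s x = podles_class q s y"
proof -
  have "podles_class q s x \<subseteq> podles_class q s y" if "x - y \<in> podles_ideal q s" for x y
  proof
    fix z assume "z \<in> podles_class q s x"
    then obtain i where i: "i \<in> podles_ideal q s" "z = i + x" by (auto simp: podles_class_eq)
    then have "z = (i + (x - y)) + y" by simp
    then show "z \<in> podles_class q s y"
      using podles_ideal_closed(2)[OF i(1) that] unfolding podles_class_eq by blast
  qed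
  from this[OF assms] this[of y x] podles_ideal_closed(3)[OF assms] show ?thesis by auto
qed

text \<open>Being its own inverse, the involution maps the ideal onto itself and not merely into
  itself; hence it carries cosets to cosets.\<close>

lemma podles_star_class: "podles_star (podles_class q s x) = podles_class q s (free_star x)"
proof -
  have "free_star ` podles_ideal q s = podles_ideal q s"
    using free_star_podles_ideal[of _ q s] free_star_free_star by (metis (no_types, lifting) image_eqI image_subsetI subsetI subset_antisym)
  then have "(\<lambda>i. i + free_star x) ` podles_ideal q s = (\<lambda>i. i + free_star x) ` free_star ` podles_ideal q s"
    by simp
  then show ?thesis
    by (simp add: podles_star_def podles_class_eq image_image free_star_add)
qed

lemma podles_class_hom: "podles_class q s \<in> ring_hom free_ring (podles_algebra q s)"
  using ideal.rcos_ring_hom[OF ideal_podles_ideal[of q s]]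
  by (simp add: podles_class_def[abs_def] podles_algebra_def)

lemma mat_mult_podles_class:
  "mat_mult_ring (podles_algebra q s) (\<chi> i j. podles_class q s (m i j)) (\<chi> i j. podles_class q s (n i j))
     = (\<chi> i j. podles_class q s (\<Sum>k\<in>UNIV. m i k * n k j))"
proof -
  interpret R: ring "podles_algebra q s"
    unfolding podles_algebra_def by (rule ideal.quotient_is_ring[OF ideal_podles_ideal])
  have cl: "podles_class q s x \<in> carrier (podles_algebra q s)" for x
    using ring_hom_closed[OF podles_class_hom, of x] by (simp add: free_ring_def)
  have mult: "podles_class q s x \<otimes>\<^bsub>podles_algebra q s\<^esub> podles_class q s y = podles_class q s (x * y)" for x y
    using ring_hom_mult[OF podles_class_hom, of x y] by (simp add: free_ring_def)
  have add: "podles_class q s x \<oplus>\<^bsub>podles_algebra q s\<^esub> podles_class q s y = podles_class q s (x + y)" for x y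
    using ring_hom_add[OF podles_class_hom, of x y] by (simp add: free_ring_def)
  show ?thesis
    by (auto simp: mat_mult_ring_def vec_eq_iff UNIV_2 mult cl add)
qed

text \<open>On representatives, each entry of \<open>P * P - P\<close> is plus or minus
  \<open>C * C\<close> times one of the relators \<open>r1\<close> to \<open>r4\<close>.
  Self-adjointness holds already in the free algebra.\<close>

lemma podles_projection:
  assumes "q \<noteq> 0"
  shows "podles_is_projection q s (podles_P q s)"
proof -
  define c where "c = 1 / (1 + s\<^sup>2)"
  define A B B' where "A = gen GenA" and "B = gen GenB" and "B' = gen GenBstar"
  define S where "S = scal (s\<^sup>2)"
  define Q where "Q = scal (q\<^sup>2)"
  define C where "C = scal c"
  define m :: "2 \<Rightarrow> 2 \<Rightarrow> podles_free" where
    "m i j = (if i = 1 then (if j = 1 then C * (1 - Q * A) else C * B)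
              else (if j = 1 then C * B' else C * (A + S)))" for i j
  note defs = A_def B_def B'_def S_def Q_def C_def
  have P: "podles_P q s = (\<chi> i j. podles_class q s (m i j))"
    by (auto simp: podles_P_def mat2_def m_def vec_eq_iff Let_def defs c_def)
  have c0: "1 + s\<^sup>2 \<noteq> 0" by (smt (verit) zero_le_power2)
  have "x * C = C * x" "x * S = S * x" "x * Q = Q * x" for x
    by (simp_all add: defs scal_central)
  note comm0 = this
  \<comment> \<open>The index sets fix the order \<open>C\<close>, \<open>S\<close>,
    \<open>Q\<close>, letters: scalars move left, and no two of them are swapped back and
    forth.\<close>
  have central: "x * C = C * x" "x * (C * y) = C * (x * y)" if "x \<in> {A, B, B', S, Q}" for x y
    by (metis comm0(1) mult.assoc)+
  have central': "x * S = S * x" "x * (S * y) = S * (x * y)" if "x \<in> {A, B, B', Q}" for x y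
    by (metis comm0(2) mult.assoc)+
  have central'': "x * Q = Q * x" "x * (Q * y) = Q * (x * y)" if "x \<in> {A, B, B'}" for x y
    by (metis comm0(3) mult.assoc)+
  note comm = central central' central'' mult.assoc
  \<comment> \<open>Here the value of the normalising constant enters; every product
    \<open>C * S\<close> is eliminated by this rule.\<close>
  have CS: "C * S = 1 - C"
  proof -
    have "C * S + C = scal (c * s\<^sup>2 + c)"
      by (simp add: defs scal_mult scal_add)
    also have "c * s\<^sup>2 + c = 1" using c0 by (simp add: c_def field_simps)
    finally show ?thesis by (simp add: scal_one eq_diff_eq)
  qed
  \<comment> \<open>\<open>r3\<close> is the commutation relator multiplied by \<open>Q\<close>,
    which clears the inverse, and \<open>r4\<close> is its adjoint. These two serve the off-diagonal
    entries, \<open>r2\<close> and \<open>r1\<close> the diagonal ones.\<close>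
  define r1 r2 r3 r4 where
    "r1 = B' * B + (A - 1) * (A + S)" and "r2 = B * B' + (Q * A - 1) * (Q * A + S)"
    and "r3 = Q * A * B - B * A" and "r4 = Q * B' * A - A * B'"
  have rel3: "A * B - scal (inverse (q\<^sup>2)) * B * A \<in> podles_ideal q s"
    and r12: "r1 \<in> podles_ideal q s" "r2 \<in> podles_ideal q s"
    using podles_ideal_generators[of q s] by (auto simp: podles_relators_def defs r1_def r2_def)
  have QQ: "Q * (scal (inverse (q\<^sup>2)) * x) = x" for x
    using assms by (simp add: defs scal_mult scal_one mult.assoc[symmetric])
  have r3: "r3 \<in> podles_ideal q s"
    using podles_ideal_closed(4)[OF rel3, of Q]
    by (simp add: r3_def right_diff_distrib QQ mult.assoc)
  have "free_star r3 = B' * (A * Q) - A * B'"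
    by (simp add: r3_def defs free_star_diff free_star_mult free_star_gen free_star_scal)
  also have "\<dots> = r4"
    by (simp add: r4_def comm)
  finally have r4: "r4 \<in> podles_ideal q s"
    using free_star_podles_ideal[OF r3] by simp
  have CS': "C * (S * x) = x - C * x" for x
    by (simp add: mult.assoc[symmetric] CS left_diff_distrib)
  have e11: "m 1 1 * m 1 1 + m 1 2 * m 2 1 - m 1 1 = C * C * r2"
    by (simp add: m_def r2_def algebra_simps comm CS CS')
  have e12: "m 1 1 * m 1 2 + m 1 2 * m 2 2 - m 1 2 = - (C * C * r3)"
    by (simp add: m_def r3_def algebra_simps comm CS CS')
  have e21: "m 2 1 * m 1 1 + m 2 2 * m 2 1 - m 2 1 = - (C * C * r4)"
    by (simp add: m_def r4_def algebra_simps comm CS CS')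
  have e22: "m 2 1 * m 1 2 + m 2 2 * m 2 2 - m 2 2 = C * C * r1"
    by (simp add: m_def r1_def algebra_simps comm CS CS')
  have "podles_class q s (\<Sum>k\<in>UNIV. m i k * m k j) = podles_class q s (m i j)" for i j
  proof (rule podles_class_eqI)
    show "(\<Sum>k\<in>UNIV. m i k * m k j) - m i j \<in> podles_ideal q s"
      using exhaust_2[of i] exhaust_2[of j]
      by (auto simp: sum_2 e11 e12 e21 e22 r12 r3 r4 podles_ideal_closed)
  qed
  moreover have "free_star (m j i) = m i j" for i j
    using exhaust_2[of i] exhaust_2[of j]
    by (auto simp: m_def defs free_star_mult free_star_gen free_star_scal free_star_diff
        free_star_one free_star_add scal_central)
  ultimately show ?thesis
    using ring_hom_closed[OF podles_class_hom]
    by (auto simp: podles_is_projection_def P mat_mult_podles_class podles_star_class free_ring_def)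
qed

section \<open>Operators on square-summable families\<close>

lemma ell2_eqI:
  assumes "\<And>i. coord u i = coord v i"
  shows "u = v"
  using assms by (simp add: coord_inject[symmetric] fun_eq_iff)

lemmas coord_simps = zero_ell2.rep_eq plus_ell2.rep_eq minus_ell2.rep_eq uminus_ell2.rep_eq
  scaleC_ell2.rep_eq

lemma ell2_norm_sq: "(ell2_norm v)\<^sup>2 = (\<Sum>\<^sub>\<infinity>i. (cmod (coord v i))\<^sup>2)"
  by (simp add: ell2_norm_def infsum_nonneg)

lemma bounded_op_linear:
  assumes "bounded_op T"
  shows "T (u + v) = T u + T v" "T (c *\<^sub>c v) = c *\<^sub>c T v"
  using assms by (auto simp: bounded_op_def)

lemma bounded_op_add:
  assumes "bounded_op S" "bounded_op T"
  shows "bounded_op (\<lambda>v. S v + T v)"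
proof -
  obtain C D where C: "\<And>v. ell2_norm (S v) \<le> C * ell2_norm v"
    and D: "\<And>v. ell2_norm (T v) \<le> D * ell2_norm v"
    using assms unfolding bounded_op_def by blast
  \<comment> \<open>Summing \<open>(a + b)^2 <= 2 a^2 + 2 b^2\<close> over the coordinates replaces
    the triangle inequality for the norm and produces this constant.\<close>
  have "ell2_norm (S v + T v) \<le> sqrt (2 * C\<^sup>2 + 2 * D\<^sup>2) * ell2_norm v" for v
  proof -
    have "(ell2_norm (S v + T v))\<^sup>2
        \<le> (\<Sum>\<^sub>\<infinity>i. 2 * (cmod (coord (S v) i))\<^sup>2 + 2 * (cmod (coord (T v) i))\<^sup>2)"
      unfolding ell2_norm_sq
    proof (rule infsum_mono)
      show "(\<lambda>i. 2 * (cmod (coord (S v) i))\<^sup>2 + 2 * (cmod (coord (T v) i))\<^sup>2) summable_on UNIV"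
        by (intro summable_on_add summable_on_cmult_right summable_coord)
      fix i
      have "(cmod (coord (S v) i + coord (T v) i))\<^sup>2
          \<le> (cmod (coord (S v) i) + cmod (coord (T v) i))\<^sup>2"
        by (intro power_mono norm_triangle_ineq) auto
      then show "(cmod (coord (S v + T v) i))\<^sup>2
          \<le> 2 * (cmod (coord (S v) i))\<^sup>2 + 2 * (cmod (coord (T v) i))\<^sup>2"
        using sum_squares_bound[of "cmod (coord (S v) i)" "cmod (coord (T v) i)"]
        by (simp add: power2_sum coord_simps)
    qed (rule summable_coord)
    also have "\<dots> = 2 * (ell2_norm (S v))\<^sup>2 + 2 * (ell2_norm (T v))\<^sup>2"
      unfolding ell2_norm_sq
      by (subst infsum_add) (auto intro!: summable_on_cmult_right summable_coord simp: infsum_cmult_right')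
    also have "\<dots> \<le> 2 * (C * ell2_norm v)\<^sup>2 + 2 * (D * ell2_norm v)\<^sup>2"
      by (intro add_mono mult_left_mono power_mono C D ell2_norm_nonneg) auto
    also have "\<dots> = (2 * C\<^sup>2 + 2 * D\<^sup>2) * (ell2_norm v)\<^sup>2"
      by (simp add: power_mult_distrib algebra_simps)
    finally have "sqrt ((ell2_norm (S v + T v))\<^sup>2) \<le> sqrt ((2 * C\<^sup>2 + 2 * D\<^sup>2) * (ell2_norm v)\<^sup>2)"
      by (rule real_sqrt_le_mono)
    then show ?thesis by (simp add: real_sqrt_mult ell2_norm_nonneg)
  qed
  moreover have "S (u + v) + T (u + v) = (S u + T u) + (S v + T v)"
    and "S (c *\<^sub>c v) + T (c *\<^sub>c v) = c *\<^sub>c (S v + T v)" for u v c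
    by (simp_all add: bounded_op_linear[OF assms(1)] bounded_op_linear[OF assms(2)])
      (simp add: ell2_eqI coord_simps algebra_simps)
  ultimately show ?thesis unfolding bounded_op_def by blast
qed

text \<open>Coordinates are pulled back along \<open>h\<close> because values on arbitrary vectors
  are needed, whereas \<open>basis_op\<close> prescribes only basis vectors. The value is meaningful
  only when the new family is square-summable.\<close>

definition weighted_comp :: "('i \<Rightarrow> complex) \<Rightarrow> ('i \<Rightarrow> 'i) \<Rightarrow> 'i op" where
  "weighted_comp f h v = Abs_ell2 (\<lambda>i. f i * coord v (h i))"

text \<open>Injectivity on the support of the weight suffices: each coordinate of the argument is
  then used at most once, so a bound on \<open>f\<close> bounds the operator.\<close>

lemma weighted_comp:
  assumes "bounded (range f)" and h: "inj_on h {i. f i \<noteq> 0}"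
  shows weighted_comp_coord: "coord (weighted_comp f h v) i = f i * coord v (h i)"
    and weighted_comp_bounded: "bounded_op (weighted_comp f h)"
proof -
  define I where "I = {i. f i \<noteq> 0}"
  obtain C where C: "\<And>i. cmod (f i) \<le> C" using assms(1) by (auto simp: bounded_iff)
  have C0: "0 \<le> C" using C[of undefined] norm_ge_zero order_trans by blast
  let ?N = "\<lambda>v i. (cmod (coord v i))\<^sup>2"
  have le: "(cmod (f i * coord v (h i)))\<^sup>2 \<le> C\<^sup>2 * ?N v (h i)" for v i
    using C[of i] by (simp add: norm_mult power_mult_distrib mult_right_mono power_mono)
  have inj: "inj_on h I" using h by (simp add: I_def)
  have sI: "(\<lambda>i. ?N v (h i)) summable_on I" for v
    using summable_on_reindex[OF inj, of "?N v"] summable_on_subset_banach[OF summable_coord, of "h ` I" v]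
    by (simp add: o_def)
  have sfI: "(\<lambda>i. (cmod (f i * coord v (h i)))\<^sup>2) summable_on I" for v
    by (rule summable_on_comparison_test[of "\<lambda>i. C\<^sup>2 * ?N v (h i)"])
      (auto intro!: summable_on_cmult_right sI le)
  then have sf: "(\<lambda>i. (cmod (f i * coord v (h i)))\<^sup>2) summable_on UNIV" for v
    by (rule summable_on_cong_neutral[THEN iffD1, rotated -1]) (auto simp: I_def)
  show coord: "coord (weighted_comp f h v) i = f i * coord v (h i)" for v i
    unfolding weighted_comp_def using Abs_ell2_inverse[of "\<lambda>i. f i * coord v (h i)"] sf[of v] by simp
  have "ell2_norm (weighted_comp f h v) \<le> C * ell2_norm v" for v
  proof -
    have "(\<Sum>\<^sub>\<infinity>i. (cmod (f i * coord v (h i)))\<^sup>2) = (\<Sum>\<^sub>\<infinity>i\<in>I. (cmod (f i * coord v (h i)))\<^sup>2)"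
      by (rule infsum_cong_neutral) (auto simp: I_def)
    also have "\<dots> \<le> (\<Sum>\<^sub>\<infinity>i\<in>I. C\<^sup>2 * ?N v (h i))"
      by (rule infsum_mono) (auto intro!: sfI summable_on_cmult_right sI le)
    also have "\<dots> = C\<^sup>2 * (\<Sum>\<^sub>\<infinity>i\<in>I. ?N v (h i))" by (rule infsum_cmult_right')
    also have "(\<Sum>\<^sub>\<infinity>i\<in>I. ?N v (h i)) = (\<Sum>\<^sub>\<infinity>i\<in>h ` I. ?N v i)"
      using infsum_reindex[OF inj, of "?N v"] by (simp add: o_def)
    also have "C\<^sup>2 * (\<Sum>\<^sub>\<infinity>i\<in>h ` I. ?N v i) \<le> C\<^sup>2 * (\<Sum>\<^sub>\<infinity>i. ?N v i)"
      by (intro mult_left_mono infsum_mono_neutral)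
        (auto intro: summable_coord summable_on_subset_banach)
    finally have "ell2_norm (weighted_comp f h v) \<le> sqrt (C\<^sup>2 * (\<Sum>\<^sub>\<infinity>i. ?N v i))"
      by (simp add: ell2_norm_def coord)
    then show ?thesis using C0 by (simp add: ell2_norm_def real_sqrt_mult)
  qed
  then show "bounded_op (weighted_comp f h)"
    unfolding bounded_op_def by (auto intro!: ell2_eqI simp: coord coord_simps algebra_simps)
qed

section \<open>Inner products, adjoints and diagonal operators\<close>

lemma cinner_ket: "cinner (ket i) v = coord v i" "cinner v (ket i) = cnj (coord v i)"
proof -
  have "cinner (ket i) v = (\<Sum>\<^sub>\<infinity>j\<in>{i}. coord v j)" "cinner v (ket i) = (\<Sum>\<^sub>\<infinity>j\<in>{i}. cnj (coord v j))"
    unfolding cinner_def by (rule infsum_cong_neutral; auto simp: ket.rep_eq split: if_splits)+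
  then show "cinner (ket i) v = coord v i" "cinner v (ket i) = cnj (coord v i)" by simp_all
qed

lemma adjoint_op_eqI:
  assumes "bounded_op S" and S: "\<And>u v. cinner (S u) v = cinner u (T v)"
  shows "adjoint_op T = S"
  unfolding adjoint_op_def
proof (rule the_equality)
  fix S' assume S': "bounded_op S' \<and> (\<forall>u v. cinner (S' u) v = cinner u (T v))"
  show "S' = S"
  proof (rule ext, rule ell2_eqI)
    fix u i
    have "cinner (S' u) (ket i) = cinner (S u) (ket i)" using S S' by simp
    then show "coord (S' u) i = coord (S u) i" by (simp add: cinner_ket)
  qed
qed (use assms in auto)

text \<open>The inner product is reindexed along \<open>h\<close> from the support of
  \<open>f\<close> to that of \<open>g\<close>. Outside the supports the summands vanish, so
  \<open>k\<close> may take junk values there.\<close>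

lemma cinner_weighted_comp:
  assumes f: "bounded (range f)" and g: "bounded (range g)"
    and h: "bij_betw h {i. f i \<noteq> 0} {j. g j \<noteq> 0}"
    and k: "\<And>i. f i \<noteq> 0 \<Longrightarrow> k (h i) = i \<and> g (h i) = cnj (f i)"
  shows "cinner (weighted_comp g k u) v = cinner u (weighted_comp f h v)"
proof -
  let ?I = "{i. f i \<noteq> 0}" and ?J = "{j. g j \<noteq> 0}"
  have "inj_on k ?J"
    by (rule inj_on_inverseI[of _ h]) (use h k in \<open>force simp: bij_betw_def\<close>)
  then have "cinner (weighted_comp g k u) v = (\<Sum>\<^sub>\<infinity>j. cnj (g j * coord u (k j)) * coord v j)"
    by (simp add: cinner_def weighted_comp_coord[OF g])
  also have "\<dots> = (\<Sum>\<^sub>\<infinity>j\<in>?J. cnj (g j * coord u (k j)) * coord v j)"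
    by (rule infsum_cong_neutral) auto
  also have "\<dots> = (\<Sum>\<^sub>\<infinity>i\<in>?I. cnj (g (h i) * coord u (k (h i))) * coord v (h i))"
    by (rule infsum_reindex_bij_betw[OF h, symmetric])
  also have "\<dots> = (\<Sum>\<^sub>\<infinity>i. cnj (coord u i) * (f i * coord v (h i)))"
    by (rule infsum_cong_neutral) (auto simp: k)
  also have "\<dots> = cinner u (weighted_comp f h v)"
    using h by (simp add: cinner_def weighted_comp_coord[OF f] bij_betw_def)
  finally show ?thesis .
qed

text \<open>Splitting the sum in \<open>cinner\<close> requires absolute summability, which follows
  from \<open>2 |a b| <= |a|^2 + |b|^2\<close>.\<close>

lemma cinner_add:
  fixes S S' T T' :: "'i op"
  assumes "\<And>u v. cinner (S u) v = cinner u (S' v)" "\<And>u v. cinner (T u) v = cinner u (T' v)"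
  shows "cinner (S u + T u) v = cinner u (S' v + T' v)"
proof -
  have summ: "(\<lambda>i. cnj (coord u i) * coord v i) summable_on UNIV" for u v :: "'i ell2"
  proof (rule abs_summable_summable, rule summable_on_comparison_test)
    show "(\<lambda>i. (cmod (coord u i))\<^sup>2 + (cmod (coord v i))\<^sup>2) summable_on UNIV"
      by (intro summable_on_add summable_coord)
    fix i
    have "2 * (cmod (coord u i) * cmod (coord v i)) \<le> (cmod (coord u i))\<^sup>2 + (cmod (coord v i))\<^sup>2"
      using sum_squares_bound[of "cmod (coord u i)" "cmod (coord v i)"] by simp
    moreover have "0 \<le> cmod (coord u i) * cmod (coord v i)" by simp
    ultimately show "cmod (cnj (coord u i) * coord v i) \<le> (cmod (coord u i))\<^sup>2 + (cmod (coord v i))\<^sup>2"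
      unfolding norm_mult complex_mod_cnj by linarith
  qed auto
  have add: "cinner (x + y) v = cinner x v + cinner y v" "cinner v (x + y) = cinner v x + cinner v y"
    for x y v :: "'i ell2"
    unfolding cinner_def
    by (simp_all add: coord_simps ring_distribs infsum_add summ)
  show ?thesis by (simp add: add assms)
qed

text \<open>The last hypothesis compares matrix entries: both sides are coordinate \<open>j\<close>
  of the image of basis vector \<open>i\<close>.\<close>

lemma basis_op_weighted_comp:
  assumes f: "bounded (range f)" and h: "inj_on h {i. f i \<noteq> 0}"
    and wh: "\<And>i j. f j * (if h j = i then 1 else 0) = w i * (if j = k i then 1 else 0)"
  shows "basis_op (\<lambda>i. w i *\<^sub>c ket (k i)) = weighted_comp f h"
  by (rule basis_op_eqI, rule weighted_comp_bounded[OF f h])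
    (rule ell2_eqI, use wh in \<open>simp add: weighted_comp_coord[OF f h] coord_simps ket.rep_eq\<close>)

text \<open>A vector \<open>u\<close> with the scaled coordinates witnesses square-summability, so
  domain membership and value come together.\<close>

lemma diag_op_eqI:
  assumes "\<And>i. of_real (d i) * coord w i = coord u i"
  shows "w \<in> diag_dom d" "diag_op d w = u"
proof -
  show "w \<in> diag_dom d" using summable_coord[of u] by (simp add: diag_dom_def assms)
  show "diag_op d w = u" by (simp add: diag_op_def assms coord_inverse)
qed

lemma diag_op_coord:
  assumes "w \<in> diag_dom d"
  shows "coord (diag_op d w) i = of_real (d i) * coord w i"
  using assms by (simp add: diag_op_def diag_dom_def Abs_ell2_inverse)

lemma positive_op_diag:
  fixes r :: "'i \<Rightarrow> real"
  assumes "\<And>i. 0 \<le> r i" "bounded (range r)"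
  shows "positive_op (weighted_comp (\<lambda>i. of_real (r i)) (\<lambda>i. i))"
proof -
  have bdd: "bounded (range (\<lambda>i. of_real (r i) :: complex))"
    using assms(2) by (simp add: bounded_iff)
  note T = weighted_comp[OF bdd, of "\<lambda>i. i", simplified]
  obtain C where C: "r i \<le> C" for i
    using assms(2) by (auto simp: bounded_iff abs_le_iff)
  have "cinner v (weighted_comp (\<lambda>i. of_real (r i)) (\<lambda>i. i) v)
      = of_real (\<Sum>\<^sub>\<infinity>i. r i * (cmod (coord v i))\<^sup>2)" for v
  proof -
    have "cnj z * (of_real a * z) = of_real (a * (cmod z)\<^sup>2)" for a z
      using complex_norm_square[of z] by (simp add: mult.commute mult.left_commute)
    then have "cinner v (weighted_comp (\<lambda>i. of_real (r i)) (\<lambda>i. i) v)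
      = (\<Sum>\<^sub>\<infinity>i. of_real (r i * (cmod (coord v i))\<^sup>2))"
      by (simp only: cinner_def T)
    also have "\<dots> = of_real (\<Sum>\<^sub>\<infinity>i. r i * (cmod (coord v i))\<^sup>2)"
    proof (rule infsumI, rule has_sum_of_real, rule has_sum_infsum, rule summable_on_comparison_test)
      show "(\<lambda>i. C * (cmod (coord v i))\<^sup>2) summable_on UNIV"
        by (intro summable_on_cmult_right summable_coord)
      fix i
      show "r i * (cmod (coord v i))\<^sup>2 \<le> C * (cmod (coord v i))\<^sup>2"
        by (intro mult_right_mono C) simp
    qed (simp add: assms(1))
    finally show ?thesis .
  qed
  then show ?thesis
    unfolding positive_op_def using T assms(1) by (auto intro!: infsum_nonneg)
qed

section \<open>Block operators in coordinates\<close>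

lemma block_op_coord:
  fixes M :: "'i op ^ 'n::finite ^ 'n"
  shows "coord (block_op M v) (i, j) = (\<Sum>k\<in>UNIV. coord ((M $ j $ k) (slice k v)) i)"
proof -
  have "coord (block_op M v) (i, j)
      = (\<Sum>l\<in>UNIV. if j = l then coord (\<Sum>k\<in>UNIV. (M $ l $ k) (slice k v)) i else 0)"
    by (simp add: block_op_def coord_sum embed.rep_eq)
  also have "\<dots> = coord (\<Sum>k\<in>UNIV. (M $ j $ k) (slice k v)) i" by simp
  finally show ?thesis by (simp add: coord_sum)
qed

lemma block_op_mat2_coord:
  "coord (block_op (mat2 a b c d) v) (i, 1) = coord (a (slice 1 v)) i + coord (b (slice 2 v)) i"
  "coord (block_op (mat2 a b c d) v) (i, 2) = coord (c (slice 1 v)) i + coord (d (slice 2 v)) i"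
  by (simp_all add: block_op_coord sum_2 mat2_def)

lemma tensor_id_coord: "coord (tensor_id T v) (i, j) = coord (T (slice j v)) i"
  using exhaust_2[of j] by (auto simp: tensor_id_def block_op_mat2_coord coord_simps)

section \<open>Evaluation of free polynomials\<close>

lemma scaleC_simps:
  "0 *\<^sub>c v = 0" "1 *\<^sub>c v = v" "c *\<^sub>c (u + v) = c *\<^sub>c u + c *\<^sub>c v" "(c + d) *\<^sub>c v = c *\<^sub>c v + d *\<^sub>c v"
  "c *\<^sub>c (d *\<^sub>c v) = (c * d) *\<^sub>c v"
  by (auto intro!: ell2_eqI simp: coord_simps algebra_simps)

lemma free_eval_single: "free_eval g (Poly_Mapping.single w c) v = c *\<^sub>c foldr g (letters w) v"
  by (simp add: free_eval_def scaleC_simps)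

lemma free_eval_add: "free_eval g (x + y) v = free_eval g x v + free_eval g y v"
  unfolding free_eval_def by (rule setsum_keys_plus_distrib) (auto simp: scaleC_simps)

lemma free_eval_zero: "free_eval g 0 v = 0"
  by (simp add: free_eval_def)

lemma free_eval_uminus: "free_eval g (- x) v = - free_eval g x v"
  using free_eval_add[of g x "- x"] free_eval_zero by (metis minus_unique right_minus)

lemma free_eval_diff: "free_eval g (x - y) v = free_eval g x v - free_eval g y v"
  using free_eval_add[of g x "- y"] by (simp add: free_eval_uminus)

lemma foldr_linear:
  assumes "\<And>l. bounded_op (g l)"
  shows "foldr g ws (u + v) = foldr g ws u + foldr g ws v"
    and "foldr g ws (c *\<^sub>c v) = c *\<^sub>c foldr g ws v"
  by (induction ws) (simp_all add: bounded_op_linear[OF assms])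

lemma free_eval_linear:
  assumes "\<And>l. bounded_op (g l)"
  shows "free_eval g x (u + v) = free_eval g x u + free_eval g x v"
    and "free_eval g x (c *\<^sub>c v) = c *\<^sub>c free_eval g x v"
  by (induction x rule: poly_mapping_single_induct)
    (simp_all add: free_eval_single free_eval_add foldr_linear[OF assms] scaleC_simps mult.commute add_ac)

lemma free_eval_mult:
  assumes "\<And>l. bounded_op (g l)"
  shows "free_eval g (x * y) v = free_eval g x (free_eval g y v)"
proof (induction x rule: poly_mapping_single_induct)
  case (single w c)
  show ?case
    by (induction y rule: poly_mapping_single_induct)
      (simp_all add: mult_single free_eval_single plus_podles_word_def scaleC_simps distrib_left
        free_eval_add foldr_linear[OF assms])
qed (simp add: distrib_right free_eval_add)

lemma free_eval_gen: "free_eval g (gen l) v = g l v"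
  by (simp add: gen_def free_eval_single scaleC_simps)

lemma free_eval_scal: "free_eval g (scal c) v = of_real c *\<^sub>c v"
  by (simp add: scal_def free_eval_single zero_podles_word_def)

lemma free_eval_one: "free_eval g 1 v = v"
  using free_eval_scal[of g 1] by (simp add: scal_one scaleC_simps)

text \<open>The polynomials that evaluate to zero form a two-sided ideal containing the generators,
  hence all of \<open>podles_ideal\<close>. So evaluation is constant on cosets, and
  \<open>the_elem\<close> in \<open>rep_of\<close> returns its value.\<close>

lemma rep_of_podles_class:
  assumes bdd: "\<And>l. bounded_op (gen_ops a b l)"
    and rel: "\<And>r v. r \<in> podles_relators q s \<union> free_star ` podles_relators q s
      \<Longrightarrow> free_eval (gen_ops a b) r v = 0"
  shows "rep_of a b (podles_class q s x) = free_eval (gen_ops a b) x"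
proof -
  let ?e = "free_eval (gen_ops a b)"
  have zero: "?e x 0 = 0" for x
    using free_eval_linear(1)[OF bdd, where u = 0 and v = 0] by simp
  have "ideal {x. \<forall>v. ?e x v = 0} free_ring"
    by (rule ideal_free_ringI)
      (auto simp: free_eval_zero free_eval_add free_eval_uminus free_eval_mult[OF bdd] zero)
  moreover have "podles_relators q s \<union> free_star ` podles_relators q s \<subseteq> {x. \<forall>v. ?e x v = 0}"
    using rel by auto
  ultimately have "podles_ideal q s \<subseteq> {x. \<forall>v. ?e x v = 0}"
    unfolding podles_ideal_def by (rule free.genideal_minimal)
  then have "?e y = ?e x" if "y \<in> podles_class q s x" for y
    using that unfolding podles_class_eq by (fastforce intro!: ext simp: free_eval_add)
  moreover have "x \<in> podles_class q s x"
    using podles_ideal_closed(1)[of q s] by (force simp: podles_class_eq)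
  ultimately have "?e ` podles_class q s x = {?e x}" by blast
  then show ?thesis by (simp add: rep_of_def)
qed

section \<open>The representations\<close>

text \<open>Both representations are instances: \<alpha> lists the eigenvalues of \<open>A\<close>
  and \<beta> the weights of \<open>B\<close>. \<open>\<beta>_sq\<close> encodes the relation for
  \<open>B* B\<close>; read one index higher, with \<open>\<alpha>_Suc\<close>, it gives the one for
  \<open>B B*\<close>.\<close>

locale podles_weights =
  fixes q s :: real and \<alpha> \<beta> :: "nat \<Rightarrow> real"
  assumes q: "q \<noteq> 0"
    and \<alpha>_Suc: "\<alpha> (Suc k) = q\<^sup>2 * \<alpha> k"
    and \<beta>_0: "\<beta> 0 = 0"
    and \<beta>_sq: "(\<beta> k)\<^sup>2 = (1 - \<alpha> k) * (\<alpha> k + s\<^sup>2)"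
    and bounded_\<alpha>: "bounded (range \<alpha>)" and bounded_\<beta>: "bounded (range \<beta>)"
begin

definition a :: "nat op" where "a = basis_op (\<lambda>k. of_real (\<alpha> k) *\<^sub>c ket k)"
definition b :: "nat op" where "b = basis_op (\<lambda>k. of_real (\<beta> k) *\<^sub>c ket (k - 1))"

lemma bounded_weights:
  "bounded (range (\<lambda>k. of_real (\<alpha> k) :: complex))"
  "bounded (range (\<lambda>k. of_real (\<beta> k) :: complex))"
  "bounded (range (\<lambda>k. of_real (\<beta> (Suc k)) :: complex))"
  using bounded_\<alpha> bounded_\<beta> by (auto simp: bounded_iff)

lemma \<beta>_nonzero: "\<beta> k \<noteq> 0 \<Longrightarrow> Suc (k - 1) = k"
  using \<beta>_0 by (cases k) auto

text \<open>The predecessor map identifies 0 and 1, but 0 lies outside the support because of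
  \<open>\<beta>_0\<close>.\<close>

lemma inj_on_shift:
  "inj_on Suc {k. complex_of_real (\<beta> (Suc k)) \<noteq> 0}"
  "inj_on (\<lambda>k. k - 1) {k. complex_of_real (\<beta> k) \<noteq> 0}"
  using \<beta>_nonzero by (simp, intro inj_on_inverseI[of _ Suc]) auto

lemma a_eq: "a = weighted_comp (\<lambda>k. of_real (\<alpha> k)) (\<lambda>k. k)"
  unfolding a_def by (rule basis_op_weighted_comp[OF bounded_weights(1)]) auto

lemma b_eq: "b = weighted_comp (\<lambda>k. of_real (\<beta> (Suc k))) Suc"
  unfolding b_def
  by (rule basis_op_weighted_comp[OF bounded_weights(3) inj_on_shift(1)])
    (use \<beta>_nonzero in auto)

lemma adjoint_b: "adjoint_op b = weighted_comp (\<lambda>k. of_real (\<beta> k)) (\<lambda>k. k - 1)"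
proof (rule adjoint_op_eqI)
  show "bounded_op (weighted_comp (\<lambda>k. of_real (\<beta> k)) (\<lambda>k. k - 1))"
    by (rule weighted_comp_bounded[OF bounded_weights(2) inj_on_shift(2)])
  have bij: "bij_betw Suc {k. complex_of_real (\<beta> (Suc k)) \<noteq> 0} {k. complex_of_real (\<beta> k) \<noteq> 0}"
  proof -
    have "k \<in> Suc ` {k. \<beta> (Suc k) \<noteq> 0}" if "\<beta> k \<noteq> 0" for k
      using that \<beta>_0 by (cases k) auto
    then show ?thesis by (auto simp: bij_betw_def)
  qed
  show "cinner (weighted_comp (\<lambda>k. of_real (\<beta> k)) (\<lambda>k. k - 1) u) v = cinner u (b v)" for u v
    unfolding b_eq
    by (rule cinner_weighted_comp[OF bounded_weights(3,2) bij]) auto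
qed

lemma generator_coord:
  "coord (a v) k = \<alpha> k * coord v k"
  "coord (b v) k = \<beta> (Suc k) * coord v (Suc k)"
  "coord (adjoint_op b v) k = \<beta> k * coord v (k - 1)"
  using weighted_comp_coord[OF bounded_weights(2) inj_on_shift(2), of v k]
  by (simp_all only: adjoint_b)
    (simp_all add: a_eq b_eq weighted_comp_coord[OF bounded_weights(1)]
      weighted_comp_coord[OF bounded_weights(3) inj_on_shift(1)])

lemma bounded_gen_ops: "bounded_op (gen_ops a b l)"
  using weighted_comp_bounded[OF bounded_weights(1)]
    weighted_comp_bounded[OF bounded_weights(3) inj_on_shift(1)]
    weighted_comp_bounded[OF bounded_weights(2) inj_on_shift(2)]
  by (cases l) (simp_all only: gen_ops.simps adjoint_b, simp_all add: a_eq b_eq)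

lemmas eval_simps = free_eval_add free_eval_diff free_eval_mult[OF bounded_gen_ops] free_eval_gen
  free_eval_scal free_eval_one

lemma relations:
  assumes "r \<in> podles_relators q s \<union> free_star ` podles_relators q s"
  shows "free_eval (gen_ops a b) r v = 0"
proof -
  let ?s = "complex_of_real s" and ?q = "complex_of_real q"
  have sq: "complex_of_real (\<beta> k) * (complex_of_real (\<beta> k) * z)
      = (1 - complex_of_real (\<alpha> k)) * ((complex_of_real (\<alpha> k) + ?s\<^sup>2) * z)" for k z
  proof -
    have "complex_of_real ((\<beta> k)\<^sup>2) = of_real ((1 - \<alpha> k) * (\<alpha> k + s\<^sup>2))" by (simp only: \<beta>_sq)
    then show ?thesis by (simp add: power2_eq_square mult.assoc[symmetric])
  qed
  have aS: "complex_of_real (\<alpha> (Suc k)) = ?q\<^sup>2 * \<alpha> k" for k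
    by (simp add: \<alpha>_Suc)
  have q': "?q \<noteq> 0" using q by simp
  show ?thesis
  proof (rule ell2_eqI)
    fix k
    note ev = podles_relators_def free_star_add free_star_diff free_star_mult free_star_gen
      free_star_scal free_star_one eval_simps coord_simps generator_coord
    show "coord (free_eval (gen_ops a b) r v) k = coord 0 k"
    proof (cases k)
      case 0
      \<comment> \<open>At index 0 the relation for \<open>B* B\<close> rests on
        \<open>\<beta> 0 = 0\<close>, which forces \<open>\<alpha> 0\<close> to be a root of the
        quadratic.\<close>
      have "\<alpha> 0 = 1 \<or> \<alpha> 0 = - s\<^sup>2" using \<beta>_sq[of 0] \<beta>_0 by auto
      then show ?thesis using assms unfolding 0
        by (auto simp: ev \<beta>_0 sq aS) (auto simp: q q' field_simps power2_eq_square)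
    next
      case (Suc m)
      show ?thesis using assms unfolding Suc
        by (auto simp: ev sq aS) (auto simp: q q' field_simps eval_nat_numeral)
    qed
  qed
qed

lemma rep_of_class: "rep_of a b (podles_class q s x) = free_eval (gen_ops a b) x"
  by (rule rep_of_podles_class[OF bounded_gen_ops relations])

end

section \<open>The trace of a cubed difference of projections\<close>

text \<open>The index set is a finite disjoint union of slices. Applied twice, this reduces sums
  over the basis of the doubled space to sums over \<open>nat\<close>.\<close>

lemma has_sum_UNIV_prod_finite:
  fixes f :: "'i \<times> 'n::finite \<Rightarrow> 'c::topological_comm_monoid_add"
  assumes "\<And>j. ((\<lambda>i. f (i, j)) has_sum a j) UNIV"
  shows "(f has_sum (\<Sum>j\<in>UNIV. a j)) UNIV"
proof -
  have "(f has_sum (\<Sum>j\<in>J. a j)) (UNIV \<times> J)" if "finite J" for J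
    using that
  proof (induction J)
    case (insert j J)
    have 1: "(f has_sum a j) (range (\<lambda>i. (i, j)))"
      using assms[of j] by (subst has_sum_reindex) (auto simp: inj_on_def o_def)
    have 2: "UNIV \<times> insert j J = range (\<lambda>i. (i, j)) \<union> UNIV \<times> J" by auto
    show ?case
      unfolding sum.insert[OF insert(1,2)] 2
      by (rule has_sum_Un_disjoint[OF 1 insert(3)]) (use insert(2) in auto)
  qed auto
  from this[of UNIV] show ?thesis by simp
qed

text \<open>The off-diagonal entries of \<open>D\<close> enter only through \<open>b 0 = 0\<close>
  and their decay, which keeps square roots of the weights out of the trace computation.\<close>

locale podles_difference =
  fixes q M :: real and b :: "nat \<Rightarrow> real"
  assumes q: "0 < q" "q < 1" and b_0: "b 0 = 0" and b_le: "\<bar>b n\<bar> \<le> M * q ^ (2 * n)"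
begin

definition x :: "nat \<Rightarrow> real" where "x n = q ^ (2 * n)"
definition c :: "nat \<Rightarrow> real" where "c n = (x n)\<^sup>2 + (b n)\<^sup>2"

text \<open>
  A basis vector lies in the block number \<open>level\<close>, whose other basis vector is \<open>partner\<close>; in the block
  of level \<open>0\<close> the value of \<open>partner\<close> is junk, which is harmless since \<open>b 0 = 0\<close>.
\<close>

definition level :: "(nat \<times> 2) \<times> 2 \<Rightarrow> nat" where
  "level = (\<lambda>((k, \<sigma>), j). if j = 1 then Suc k else k)"

definition sg :: "(nat \<times> 2) \<times> 2 \<Rightarrow> real" where
  "sg = (\<lambda>((k, \<sigma>), j). if j = 1 then 1 else - 1)"

definition partner :: "(nat \<times> 2) \<times> 2 \<Rightarrow> (nat \<times> 2) \<times> 2" where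
  "partner = (\<lambda>((k, \<sigma>), j). if j = 1 then ((Suc k, \<sigma>), 2) else ((k - 1, \<sigma>), 1))"

text \<open>Diagonal entries of the modular operator times \<open>- D^3\<close>. On a block
  \<open>D^3 = c D\<close>, and the modular eigenvalue \<open>q / x\<close> cancels the diagonal
  entry \<open>x\<close> of \<open>D\<close> up to sign.\<close>

definition diag_weight :: "(nat \<times> 2) \<times> 2 \<Rightarrow> real" where
  "diag_weight i = sg i * q * c (level i)"

definition off_weight :: "(nat \<times> 2) \<times> 2 \<Rightarrow> real" where
  "off_weight i = - (q * c (level i) * b (level i) / x (level i))"

text \<open>On a block \<open>D^2\<close> is the scalar \<open>c\<close>, so the absolute value of
  \<open>D^3\<close> is \<open>c * sqrt c\<close>; the modular scalar \<open>q / x\<close>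
  multiplies it.\<close>

definition abs_weight :: "(nat \<times> 2) \<times> 2 \<Rightarrow> real" where
  "abs_weight i = q * c (level i) * sqrt (c (level i)) / x (level i)"

definition T :: "((nat \<times> 2) \<times> 2) op" where
  "T v = weighted_comp (\<lambda>i. of_real (diag_weight i)) (\<lambda>i. i) v
       + weighted_comp (\<lambda>i. of_real (off_weight i)) partner v"

section \<open>Estimates for the weights\<close>

lemma x_pos: "0 < x n" and x_le_1: "x n \<le> 1"
  using q by (simp_all add: x_def power_le_one)

lemma M_nonneg: "0 \<le> M"
  using b_le[of 0] by (auto simp: b_0)

lemma c_nonneg: "0 \<le> c n"
  by (simp add: c_def)

lemma c_le: "c n \<le> (1 + M\<^sup>2) * (x n)\<^sup>2"
proof -
  have "(b n)\<^sup>2 \<le> (M * x n)\<^sup>2"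
    using power_mono[of "\<bar>b n\<bar>" "M * x n" 2] b_le[of n] by (simp add: x_def)
  then show ?thesis by (simp add: c_def power_mult_distrib algebra_simps)
qed

lemma sqrt_c_le: "sqrt (c n) \<le> sqrt (1 + M\<^sup>2) * x n"
  using real_sqrt_le_mono[OF c_le[of n]] x_pos[of n] by (simp add: real_sqrt_mult)

lemma c_le_const: "c n \<le> 1 + M\<^sup>2"
proof -
  have "(x n)\<^sup>2 \<le> 1" using x_pos[of n] x_le_1[of n] by (simp add: power_le_one)
  then have "(1 + M\<^sup>2) * (x n)\<^sup>2 \<le> (1 + M\<^sup>2) * 1" by (intro mult_left_mono) auto
  then show ?thesis using c_le[of n] by simp
qed

lemma abs_weight_nonneg: "0 \<le> abs_weight i"
  using q x_pos[of "level i"] c_nonneg[of "level i"] by (simp add: abs_weight_def)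

text \<open>The factors \<open>c\<close> and \<open>sqrt c\<close> decay like \<open>x^2\<close> and
  \<open>x\<close>; after division by \<open>x\<close> a geometric, hence summable, bound
  remains.\<close>

lemma abs_weight_le: "abs_weight i \<le> q * (1 + M\<^sup>2) * sqrt (1 + M\<^sup>2) * (x (level i))\<^sup>2"
proof -
  let ?n = "level i"
  have "q * c ?n * sqrt (c ?n) \<le> q * ((1 + M\<^sup>2) * (x ?n)\<^sup>2) * (sqrt (1 + M\<^sup>2) * x ?n)"
    using q x_pos[of ?n]
    by (intro mult_mono c_le sqrt_c_le mult_left_mono mult_nonneg_nonneg) (auto simp: c_nonneg)
  also have "\<dots> = q * (1 + M\<^sup>2) * sqrt (1 + M\<^sup>2) * (x ?n)\<^sup>2 * x ?n" by simp
  finally show ?thesis using x_pos[of ?n] by (simp add: abs_weight_def pos_divide_le_eq)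
qed

lemma bounded_weights:
  "bounded (range diag_weight)" "bounded (range off_weight)" "bounded (range abs_weight)"
proof -
  have "\<bar>diag_weight i\<bar> \<le> q * (1 + M\<^sup>2)" for i
    using q c_le_const[of "level i"] c_nonneg[of "level i"]
    by (auto simp: diag_weight_def sg_def abs_mult split: prod.splits)
  then show "bounded (range diag_weight)" by (auto simp: bounded_iff)
  have "\<bar>off_weight i\<bar> \<le> q * (1 + M\<^sup>2) * M" for i
  proof -
    let ?n = "level i"
    have "\<bar>off_weight i\<bar> = q * c ?n * (\<bar>b ?n\<bar> / x ?n)"
      using q x_pos[of ?n] c_nonneg[of ?n] by (simp add: off_weight_def abs_mult)
    also have "\<bar>b ?n\<bar> / x ?n \<le> M"
      using b_le[of ?n] x_pos[of ?n] by (simp add: pos_divide_le_eq x_def)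
    then have "q * c ?n * (\<bar>b ?n\<bar> / x ?n) \<le> q * (1 + M\<^sup>2) * M"
      using q x_pos[of ?n] M_nonneg
      by (intro mult_mono c_le_const) (auto simp: c_nonneg)
    finally show ?thesis .
  qed
  then show "bounded (range off_weight)" by (auto simp: bounded_iff)
  have "\<bar>abs_weight i\<bar> \<le> q * (1 + M\<^sup>2) * sqrt (1 + M\<^sup>2) * 1" for i
  proof -
    have "(x (level i))\<^sup>2 \<le> 1" using x_pos[of "level i"] x_le_1[of "level i"] by (simp add: power_le_one)
    then have "q * (1 + M\<^sup>2) * sqrt (1 + M\<^sup>2) * (x (level i))\<^sup>2 \<le> q * (1 + M\<^sup>2) * sqrt (1 + M\<^sup>2) * 1"
      using q by (intro mult_left_mono) auto
    then show ?thesis using abs_weight_le[of i] abs_weight_nonneg[of i] by linarith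
  qed
  then show "bounded (range abs_weight)" by (auto simp: bounded_iff)
qed

lemma bounded_complex_weights:
  "bounded (range (\<lambda>i. of_real (diag_weight i) :: complex))"
  "bounded (range (\<lambda>i. of_real (off_weight i) :: complex))"
  "bounded (range (\<lambda>i. of_real (abs_weight i) :: complex))"
  using bounded_weights by (auto simp: bounded_iff)

lemma partner_off_weight:
  assumes "off_weight i \<noteq> 0"
  shows "partner (partner i) = i" "level (partner i) = level i" "sg (partner i) = - sg i"
    "off_weight (partner i) = off_weight i"
proof -
  obtain k \<sigma> j where i: "i = ((k, \<sigma>), j)" by (metis prod.collapse)
  \<comment> \<open>Level 0 occurs only for \<open>j = 2\<close> and \<open>k = 0\<close>. There the
    partner is junk, and \<open>b 0 = 0\<close> makes the weight vanish.\<close>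
  have "j = 1 \<or> k \<noteq> 0"
    using assms by (cases k) (auto simp: off_weight_def level_def i b_0 split: if_splits)
  then show p: "partner (partner i) = i" "level (partner i) = level i" "sg (partner i) = - sg i"
    using exhaust_2[of j] by (auto simp: partner_def level_def sg_def i)
  then show "off_weight (partner i) = off_weight i" by (simp add: off_weight_def)
qed

lemma inj_on_partner: "inj_on partner {i. complex_of_real (off_weight i) \<noteq> 0}"
  by (rule inj_on_inverseI[of _ partner]) (simp add: partner_off_weight)

section \<open>The adjoint and the absolute value of \<open>T\<close>\<close>

lemma T_coord: "coord (T v) i = diag_weight i * coord v i + off_weight i * coord v (partner i)"
  by (simp add: T_def coord_simps weighted_comp_coord[OF bounded_complex_weights(1)]
      weighted_comp_coord[OF bounded_complex_weights(2) inj_on_partner])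

lemma bounded_T: "bounded_op T"
  unfolding T_def[abs_def]
  by (intro bounded_op_add weighted_comp_bounded[OF bounded_complex_weights(1)]
      weighted_comp_bounded[OF bounded_complex_weights(2) inj_on_partner]) auto

lemma adjoint_T: "adjoint_op T = T"
proof (rule adjoint_op_eqI[OF bounded_T])
  have "bij_betw partner {i. complex_of_real (off_weight i) \<noteq> 0} {i. complex_of_real (off_weight i) \<noteq> 0}"
    by (rule bij_betw_byWitness[of _ partner]) (auto simp: partner_off_weight)
  then show "cinner (T u) v = cinner u (T v)" for u v
    unfolding T_def
    by (intro cinner_add cinner_weighted_comp bounded_complex_weights)
      (auto simp: partner_off_weight bij_betw_def)
qed

text \<open>Partners carry opposite diagonal weights, so the cross terms in the square of a block
  cancel. As \<open>T\<close> is self-adjoint, this identifies its absolute value as a diagonal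
  operator.\<close>

lemma T_T: "T \<circ> T = weighted_comp (\<lambda>i. of_real (abs_weight i)) (\<lambda>i. i)
    \<circ> weighted_comp (\<lambda>i. of_real (abs_weight i)) (\<lambda>i. i)"
proof (rule ext, rule ell2_eqI)
  fix v i
  let ?n = "level i"
  have sq: "(diag_weight i)\<^sup>2 + (off_weight i)\<^sup>2 = (abs_weight i)\<^sup>2"
  proof -
    have "(sg i)\<^sup>2 = 1" by (auto simp: sg_def split: prod.splits)
    then have "(diag_weight i)\<^sup>2 + (off_weight i)\<^sup>2 = (q * c ?n)\<^sup>2 * (1 + (b ?n)\<^sup>2 / (x ?n)\<^sup>2)"
      by (simp add: diag_weight_def off_weight_def power_mult_distrib power_divide algebra_simps)
    also have "1 + (b ?n)\<^sup>2 / (x ?n)\<^sup>2 = c ?n / (x ?n)\<^sup>2"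
      using x_pos[of ?n] by (simp add: c_def add_divide_distrib)
    also have "(q * c ?n)\<^sup>2 * (c ?n / (x ?n)\<^sup>2) = (abs_weight i)\<^sup>2"
      using c_nonneg[of ?n] by (simp add: abs_weight_def power_mult_distrib power_divide)
    finally show ?thesis .
  qed
  have "coord (T (T v)) i = ((diag_weight i)\<^sup>2 + (off_weight i)\<^sup>2) * coord v i"
  proof (cases "off_weight i = 0")
    case True
    then show ?thesis by (simp add: T_coord power2_eq_square)
  next
    case False
    have "diag_weight (partner i) = - diag_weight i"
      by (simp add: diag_weight_def partner_off_weight[OF False])
    then show ?thesis
      by (simp add: T_coord partner_off_weight[OF False]) (simp add: power2_eq_square algebra_simps)
  qed
  then show "coord ((T \<circ> T) v) i = coord ((weighted_comp (\<lambda>i. of_real (abs_weight i)) (\<lambda>i. i)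
    \<circ> weighted_comp (\<lambda>i. of_real (abs_weight i)) (\<lambda>i. i)) v) i"
    unfolding sq
    by (simp add: weighted_comp_coord[OF bounded_complex_weights(3)] power2_eq_square)
qed

section \<open>Summability and the trace\<close>

lemma summable_x_sq: "summable (\<lambda>n. (x n)\<^sup>2)"
proof -
  have "(\<lambda>n. (x n)\<^sup>2) = (\<lambda>n. (q ^ 4) ^ n)"
    by (simp add: x_def fun_eq_iff flip: power_mult)
  moreover have "norm (q ^ 4) < 1" using q by (simp add: power_less_one_iff)
  ultimately show ?thesis using summable_geometric by metis
qed

lemma summable_level:
  assumes f: "\<And>i. 0 \<le> f i" "\<And>i. f i \<le> C * (x (level i))\<^sup>2"
  shows "f summable_on UNIV"
proof -
  have "\<exists>a. ((\<lambda>k. f ((k, \<sigma>), j)) has_sum a) UNIV" for \<sigma> j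
  proof -
    have "summable (\<lambda>k. C * (x (Suc k))\<^sup>2)" "summable (\<lambda>k. C * (x k)\<^sup>2)"
      using summable_x_sq summable_Suc_iff[of "\<lambda>n. (x n)\<^sup>2"] by (auto intro: summable_mult)
    then have "summable (\<lambda>k. C * (x (level ((k, \<sigma>), j)))\<^sup>2)"
      by (cases "j = 1") (simp_all add: level_def)
    then have "summable (\<lambda>k. f ((k, \<sigma>), j))"
      by (rule summable_comparison_test'[where N = 0]) (simp add: f)
    then show ?thesis
      using summable_on_UNIV_nonneg_real_iff[of "\<lambda>k. f ((k, \<sigma>), j)"] f(1) summable_on_def by blast
  qed
  then obtain a where "((\<lambda>k. f ((k, \<sigma>), j)) has_sum a \<sigma> j) UNIV" for \<sigma> j
    by metis
  then have "(f has_sum (\<Sum>j\<in>UNIV. \<Sum>\<sigma>\<in>UNIV. a \<sigma> j)) UNIV"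
    by (intro has_sum_UNIV_prod_finite)
  then show ?thesis by (auto simp: summable_on_def)
qed

lemma trace_class_T: "trace_class T"
  unfolding trace_class_def adjoint_T
proof (intro conjI exI)
  show "positive_op (weighted_comp (\<lambda>i. of_real (abs_weight i)) (\<lambda>i. i))"
    by (rule positive_op_diag[OF abs_weight_nonneg bounded_weights(3)])
  have "coord (weighted_comp (\<lambda>i. of_real (abs_weight i)) (\<lambda>i. i) (ket i)) i = abs_weight i" for i
    by (simp add: weighted_comp_coord[OF bounded_complex_weights(3)] ket.rep_eq)
  then show "(\<lambda>i. Re (cinner (ket i) (weighted_comp (\<lambda>i. of_real (abs_weight i)) (\<lambda>i. i) (ket i))))
      summable_on UNIV"
    unfolding cinner_ket
    using summable_level[OF abs_weight_nonneg abs_weight_le] by simp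
qed (use bounded_T T_T in auto)

text \<open>For \<open>j = 1\<close> the levels start at 1 with positive sign, for
  \<open>j = 2\<close> at 0 with negative sign. The two convergent sums of \<open>c\<close> differ
  by \<open>c 0 = 1\<close>, once for each value of \<sigma>.\<close>

lemma trace_T: "trace_op T = - 2 * of_real q"
proof -
  have "summable c"
    by (rule summable_comparison_test'[where N = 0, OF summable_mult[OF summable_x_sq, of "1 + M\<^sup>2"]])
      (use c_le c_nonneg in auto)
  then have c: "c sums suminf c" by (rule summable_sums)
  then have "(\<lambda>k. c (Suc k)) sums (suminf c - c 0)" by (simp add: sums_Suc_iff)
  then have c1: "((\<lambda>k. c (Suc k)) has_sum (suminf c - c 0)) UNIV"
    by (rule sums_nonneg_imp_has_sum) (rule c_nonneg)
  have c2: "(c has_sum suminf c) UNIV"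
    by (rule sums_nonneg_imp_has_sum[OF c]) (rule c_nonneg)
  have "((\<lambda>k. diag_weight ((k, \<sigma>), j)) has_sum
      (if j = 1 then q * (suminf c - c 0) else - q * suminf c)) UNIV" for \<sigma> j
    using has_sum_cmult_right[OF c1, of q] has_sum_cmult_right[OF c2, of "- q"]
    by (auto simp: diag_weight_def sg_def level_def)
  then have "(diag_weight has_sum (\<Sum>j\<in>(UNIV :: 2 set). \<Sum>\<sigma>\<in>(UNIV :: 2 set).
      if j = 1 then q * (suminf c - c 0) else - q * suminf c)) UNIV"
    by (intro has_sum_UNIV_prod_finite)
  also have "(\<Sum>j\<in>(UNIV :: 2 set). \<Sum>\<sigma>\<in>(UNIV :: 2 set).
      if j = 1 then q * (suminf c - c 0) else - q * suminf c) = - 2 * q"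
    by (simp add: sum_2 c_def x_def b_0 algebra_simps)
  finally have "((\<lambda>i. complex_of_real (diag_weight i)) has_sum of_real (- 2 * q)) UNIV"
    by (rule has_sum_of_real)
  moreover have "cinner (ket i) (T (ket i)) = diag_weight i" for i
  proof -
    \<comment> \<open>Partners differ in the last index, so the off-diagonal part contributes
      nothing to the trace.\<close>
    have "partner i \<noteq> i" by (auto simp: partner_def split: prod.splits)
    then show ?thesis by (simp add: cinner_ket T_coord ket.rep_eq)
  qed
  ultimately show ?thesis by (simp add: trace_op_def infsumI)
qed

end

section \<open>The Chern character\<close>

text \<open>The index \<sigma> matches the second component of the basis labels, 1 for plus and 2
  for minus, so that one coordinate formula serves both representations.\<close>

definition podles_\<alpha> :: "real \<Rightarrow> real \<Rightarrow> 2 \<Rightarrow> nat \<Rightarrow> real" where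
  "podles_\<alpha> q s \<sigma> k = (if \<sigma> = 1 then q ^ (2 * k) else - s\<^sup>2 * q ^ (2 * k))"

definition podles_\<beta> :: "real \<Rightarrow> real \<Rightarrow> 2 \<Rightarrow> nat \<Rightarrow> real" where
  "podles_\<beta> q s \<sigma> k =
     (if \<sigma> = 1 then sqrt (1 - q ^ (2 * k)) * sqrt (s\<^sup>2 + q ^ (2 * k))
      else s * sqrt (1 - q ^ (2 * k)) * sqrt (1 + s\<^sup>2 * q ^ (2 * k)))"

lemma podles_weights:
  fixes q s :: real
  assumes "0 < q" "q < 1"
  shows "podles_weights q s (podles_\<alpha> q s \<sigma>) (podles_\<beta> q s \<sigma>)"
proof
  have x: "0 \<le> q ^ (2 * k)" "q ^ (2 * k) \<le> 1" for k
    using assms by (simp_all add: power_le_one)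
  show "q \<noteq> 0" using assms by simp
  show "podles_\<alpha> q s \<sigma> (Suc k) = q\<^sup>2 * podles_\<alpha> q s \<sigma> k" for k
    by (simp add: podles_\<alpha>_def power2_eq_square)
  show "podles_\<beta> q s \<sigma> 0 = 0" by (simp add: podles_\<beta>_def)
  show "(podles_\<beta> q s \<sigma> k)\<^sup>2 = (1 - podles_\<alpha> q s \<sigma> k) * (podles_\<alpha> q s \<sigma> k + s\<^sup>2)" for k
    using x[of k] by (simp add: podles_\<alpha>_def podles_\<beta>_def power_mult_distrib algebra_simps)
  have "\<bar>podles_\<alpha> q s \<sigma> k\<bar> \<le> 1 + s\<^sup>2" for k
    using x[of k] mult_left_mono[OF x(2)[of k], of "s\<^sup>2"]
    by (auto simp: podles_\<alpha>_def abs_mult intro: order_trans)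
  then show "bounded (range (podles_\<alpha> q s \<sigma>))" by (auto simp: bounded_iff)
  have "\<bar>podles_\<beta> q s \<sigma> k\<bar> \<le> (1 + \<bar>s\<bar>) * (1 * sqrt (1 + s\<^sup>2))" for k
  proof -
    have 1: "sqrt (1 - q ^ (2 * k)) \<le> 1" using x[of k] by simp
    have 2: "sqrt (s\<^sup>2 + q ^ (2 * k)) \<le> sqrt (1 + s\<^sup>2)" using x[of k] by simp
    have 3: "sqrt (1 + s\<^sup>2 * q ^ (2 * k)) \<le> sqrt (1 + s\<^sup>2)"
      using mult_left_mono[OF x(2)[of k], of "s\<^sup>2"] by simp
    have "1 * (sqrt (1 - q ^ (2 * k)) * sqrt (s\<^sup>2 + q ^ (2 * k))) \<le> (1 + \<bar>s\<bar>) * (1 * sqrt (1 + s\<^sup>2))"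
      "\<bar>s\<bar> * (sqrt (1 - q ^ (2 * k)) * sqrt (1 + s\<^sup>2 * q ^ (2 * k))) \<le> (1 + \<bar>s\<bar>) * (1 * sqrt (1 + s\<^sup>2))"
      using x[of k] by (intro mult_mono 1 2 3; simp)+
    then show ?thesis using x[of k] by (simp add: podles_\<beta>_def abs_mult mult.assoc)
  qed
  then show "bounded (range (podles_\<beta> q s \<sigma>))" by (auto simp: bounded_iff)
qed

section \<open>The projection in coordinates\<close>

definition podles_pi :: "real \<Rightarrow> real \<Rightarrow> 2 \<Rightarrow> podles_free set \<Rightarrow> nat op" where
  "podles_pi q s \<sigma> = (if \<sigma> = 1 then pi_plus q s else pi_minus q s)"

lemma podles_rep_coord: "coord (podles_rep q s X v) (k, \<sigma>) = coord (podles_pi q s \<sigma> X (slice \<sigma> v)) k"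
  using exhaust_2[of \<sigma>]
  by (auto simp: podles_rep_def podles_pi_def block_op_mat2_coord coord_simps)

text \<open>The entries of \<open>P\<close> are affine in the generators, so \<open>P\<close>
  couples \<open>((k, \<sigma>), 1)\<close> only with \<open>((Suc k, \<sigma>), 2)\<close>; these
  are the blocks of the trace computation. At \<open>k = 0\<close> the weight vanishes and makes the
  truncated \<open>k - 1\<close> harmless.\<close>

lemma podles_rep_mat_coord:
  fixes q s :: real
  assumes "0 < q" "q < 1"
  defines "p \<equiv> podles_rep_mat q s (podles_P q s)" and "N \<equiv> 1 + s\<^sup>2"
  shows "coord (p v) ((k, \<sigma>), 1) =
      (1 - q\<^sup>2 * podles_\<alpha> q s \<sigma> k) / N * coord v ((k, \<sigma>), 1)
      + podles_\<beta> q s \<sigma> (Suc k) / N * coord v ((Suc k, \<sigma>), 2)" (is ?th1)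
    and "coord (p v) ((k, \<sigma>), 2) =
      podles_\<beta> q s \<sigma> k / N * coord v ((k - 1, \<sigma>), 1)
      + (podles_\<alpha> q s \<sigma> k + s\<^sup>2) / N * coord v ((k, \<sigma>), 2)" (is ?th2)
proof -
  interpret podles_weights q s "podles_\<alpha> q s \<sigma>" "podles_\<beta> q s \<sigma>"
    by (rule podles_weights[OF assms(1,2)])
  have pi: "podles_pi q s \<sigma> (podles_class q s x) = free_eval (gen_ops a b) x" for x
    unfolding rep_of_class[symmetric] unfolding a_def b_def
    by (simp add: podles_pi_def pi_plus_def pi_minus_def A_plus_def B_plus_def A_minus_def
        B_minus_def podles_\<alpha>_def[abs_def] podles_\<beta>_def[abs_def])
  show ?th1 ?th2
    by (simp_all add: p_def podles_rep_mat_def block_op_coord sum_2 podles_rep_coord podles_P_def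
        Let_def mat2_def pi eval_simps coord_simps generator_coord slice.rep_eq N_def)
      (simp_all add: algebra_simps)
qed

lemma podles_commutes:
  fixes q s :: real
  assumes "0 < q" "q < 1"
  shows "commutes_with_diag (K_Delta_eig q) (podles_rep_mat q s (podles_P q s))"
  unfolding commutes_with_diag_def
proof (rule ballI)
  fix v assume v: "v \<in> diag_dom (K_Delta_eig q)"
  let ?P = "podles_rep_mat q s (podles_P q s)" and ?d = "K_Delta_eig q"
  interpret podles_weights q s "podles_\<alpha> q s \<sigma>" "podles_\<beta> q s \<sigma>" for \<sigma>
    by (rule podles_weights[OF assms])
  have "of_real (?d i) * coord (?P v) i = coord (?P (diag_op ?d v)) i" for i
  proof -
    obtain k \<sigma> j where i: "i = ((k, \<sigma>), j)" by (metis prod.collapse)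
    \<comment> \<open>Raising \<open>k\<close> by one multiplies the eigenvalue of \<open>K\<close>
      by \<open>q^(-2)\<close>, exactly the ratio of the two eigenvalues of \<Delta>. Hence basis
      vectors coupled by \<open>P\<close> share their modular eigenvalue.\<close>
    have "?d ((Suc k, \<sigma>), 2) = ?d ((k, \<sigma>), 1)" for k
      using assms by (simp add: K_Delta_eig_def K_eig_def power2_eq_square field_simps)
    then show ?thesis
      using exhaust_2[of j] \<beta>_0
      by (cases k) (auto simp: i podles_rep_mat_coord[OF assms] diag_op_coord[OF v] algebra_simps)
  qed
  then show "?P v \<in> diag_dom ?d \<and> diag_op ?d (?P v) = ?P (diag_op ?d v)"
    using diag_op_eqI[of ?d "?P v" "?P (diag_op ?d v)"] by blast
qed

section \<open>Decay of the off-diagonal entries\<close>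

definition podles_b :: "real \<Rightarrow> real \<Rightarrow> nat \<Rightarrow> real" where
  "podles_b q s n = (podles_\<beta> q s 1 n - podles_\<beta> q s 2 n) / (1 + s\<^sup>2)"

text \<open>With \<open>x = q^(2n)\<close>, the roots \<open>sqrt (s^2 + x)\<close> and
  \<open>s * sqrt (1 + s^2 * x)\<close> are both at least \<open>s\<close> and exceed it by at most
  \<open>x / s\<close> and \<open>s^3 * x\<close>. The two excesses add up to the constant.\<close>

lemma podles_difference:
  fixes q s :: real
  assumes "0 < q" "q < 1" "0 < s"
  shows "podles_difference q (1 / s + s ^ 3) (podles_b q s)"
proof
  show "podles_b q s 0 = 0" by (simp add: podles_b_def podles_\<beta>_def)
  fix n
  define x where "x = q ^ (2 * n)"
  have x: "0 \<le> x" "x \<le> 1" using assms by (simp_all add: x_def power_le_one)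
  have "sqrt (s\<^sup>2 + x) \<le> s + x / s"
    using assms x by (intro real_le_lsqrt) (auto simp: power2_sum)
  moreover have "s \<le> sqrt (s\<^sup>2 + x)" using x by (intro real_le_rsqrt) auto
  moreover have "sqrt (1 + s\<^sup>2 * x) \<le> 1 + s\<^sup>2 * x"
    using x by (intro real_le_lsqrt) (auto simp: power2_sum)
  then have "s * sqrt (1 + s\<^sup>2 * x) \<le> s + s ^ 3 * x"
    using mult_left_mono[of "sqrt (1 + s\<^sup>2 * x)" "1 + s\<^sup>2 * x" s] assms(3)
    by (simp add: algebra_simps power2_eq_square power3_eq_cube)
  moreover have "s * 1 \<le> s * sqrt (1 + s\<^sup>2 * x)"
    using x assms(3) by (intro mult_left_mono) auto
  moreover have "0 \<le> x / s" "0 \<le> s ^ 3 * x" using x assms by auto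
  ultimately have diff: "\<bar>sqrt (s\<^sup>2 + x) - s * sqrt (1 + s\<^sup>2 * x)\<bar> \<le> (1 / s + s ^ 3) * x"
    by (simp add: distrib_right)
  have "podles_b q s n = sqrt (1 - x) * (sqrt (s\<^sup>2 + x) - s * sqrt (1 + s\<^sup>2 * x)) / (1 + s\<^sup>2)"
    by (simp add: podles_b_def podles_\<beta>_def x_def algebra_simps)
  then have "\<bar>podles_b q s n\<bar> = sqrt (1 - x) / (1 + s\<^sup>2) * \<bar>sqrt (s\<^sup>2 + x) - s * sqrt (1 + s\<^sup>2 * x)\<bar>"
    using x by (simp add: abs_mult)
  also have "\<dots> \<le> 1 * ((1 / s + s ^ 3) * x)"
  proof (intro mult_mono diff)
    have "sqrt (1 - x) \<le> 1" "0 < 1 + s\<^sup>2" "1 \<le> 1 + s\<^sup>2" using x by (auto simp: add_pos_nonneg)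
    then show "sqrt (1 - x) / (1 + s\<^sup>2) \<le> 1" by (metis pos_divide_le_eq mult_1 order_trans)
  qed auto
  finally show "\<bar>podles_b q s n\<bar> \<le> (1 / s + s ^ 3) * q ^ (2 * n)" by (simp add: x_def)
qed (use assms in auto)

section \<open>The triple commutator\<close>

lemma chern_F_coord:
  "coord (tensor_id F_op v) ((k, 1), j) = coord v ((k, 2), j)"
  "coord (tensor_id F_op v) ((k, 2), j) = coord v ((k, 1), j)"
  by (simp_all add: tensor_id_coord F_op_def block_op_mat2_coord coord_simps slice.rep_eq)

lemma chern_gamma_coord:
  "coord (tensor_id gamma_op v) ((k, 1), j) = coord v ((k, 1), j)"
  "coord (tensor_id gamma_op v) ((k, 2), j) = - coord v ((k, 2), j)"
  by (simp_all add: tensor_id_coord gamma_op_def block_op_mat2_coord coord_simps slice.rep_eq)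

lemma podles_chern_T:
  fixes q s :: real
  assumes "0 < q" "q < 1" "0 < s"
  defines "P \<equiv> podles_rep_mat q s (podles_P q s)" and "d \<equiv> K_Delta_eig q"
  defines "C \<equiv> chern_bounded_part (tensor_id gamma_op) (tensor_id F_op) P P P"
  shows "C v \<in> diag_dom d" and "diag_op d (C v) = podles_difference.T q (podles_b q s) v"
proof -
  interpret podles_difference q "1 / s + s ^ 3" "podles_b q s"
    by (rule podles_difference[OF assms(1-3)])
  let ?b = "podles_b q s"
  define X where "X = comm_op (tensor_id F_op) P"
  have N: "1 + s\<^sup>2 \<noteq> 0"
    by (smt (verit) zero_le_power2)
  have x_eq: "(podles_\<alpha> q s 1 k - podles_\<alpha> q s 2 k) / (1 + s\<^sup>2) = x k" for k
    using N by (simp add: podles_\<alpha>_def x_def field_simps)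
  have x_Suc: "x (Suc k) = q\<^sup>2 * x k" for k
    by (simp add: x_def power2_eq_square)
  have \<alpha>_Suc: "podles_\<alpha> q s \<sigma> (Suc k) = q\<^sup>2 * podles_\<alpha> q s \<sigma> k" for \<sigma> k
    by (rule podles_weights.\<alpha>_Suc[OF podles_weights[OF assms(1,2)]])
  \<comment> \<open>Conjugating by \<open>F\<close> turns entries into differences of the two
    representations. In the corner \<open>1 - q^2 A\<close> the factor \<open>q^2\<close> raises
    \<open>x k\<close> to \<open>x (Suc k)\<close>, the value at the level of that vector.\<close>
  have X: "coord (X v) ((k, 1), 1) = x (Suc k) * coord v ((k, 2), 1) - ?b (Suc k) * coord v ((Suc k, 2), 2)"
    "coord (X v) ((k, 2), 1) = ?b (Suc k) * coord v ((Suc k, 1), 2) - x (Suc k) * coord v ((k, 1), 1)"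
    "coord (X v) ((k, 1), 2) = - (?b k * coord v ((k - 1, 2), 1)) - x k * coord v ((k, 2), 2)"
    "coord (X v) ((k, 2), 2) = ?b k * coord v ((k - 1, 1), 1) + x k * coord v ((k, 1), 2)" for v k
    unfolding X_def comm_op_def P_def podles_b_def x_Suc x_eq[symmetric]
    by (simp_all add: coord_simps chern_F_coord podles_rep_mat_coord[OF assms(1,2)])
      (simp_all add: \<alpha>_Suc diff_divide_distrib add_divide_distrib algebra_simps)
  \<comment> \<open>The mixed terms cancel within each block, so the square of the commutator is a
    scalar there and the cube needs only one more use of \<open>X\<close>.\<close>
  have XX: "coord (X (X v)) i = - (c (level i) * coord v i)" for v i
  proof -
    obtain k \<sigma> j where i: "i = ((k, \<sigma>), j)" by (metis prod.collapse)
    show ?thesis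
      using exhaust_2[of j] exhaust_2[of \<sigma>] b_0
      by (cases k) (auto simp: i X level_def c_def power2_eq_square algebra_simps)
  qed
  have C: "C v = tensor_id gamma_op (tensor_id F_op (X (X (X v))))" for v
    by (simp add: C_def chern_bounded_part_def X_def)
  have C_coord: "coord (C v) i = sg i * x (level i) * c (level i) * coord v i
      - c (level i) * ?b (level i) * coord v (partner i)" for i
  proof -
    obtain k \<sigma> j where i: "i = ((k, \<sigma>), j)" by (metis prod.collapse)
    show ?thesis
      using exhaust_2[of j] exhaust_2[of \<sigma>]
      by (auto simp: i C chern_F_coord chern_gamma_coord XX)
        (auto simp: X level_def sg_def partner_def algebra_simps)
  qed
  \<comment> \<open>The modular eigenvalue depends on the level alone: for \<open>j = 1\<close> the
    factor \<open>inverse q\<close> of \<Delta> makes up for the level being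
    \<open>Suc k\<close>.\<close>
  have d: "d i = q / x (level i)" for i
  proof -
    obtain k \<sigma> j where i: "i = ((k, \<sigma>), j)" by (metis prod.collapse)
    show ?thesis
      using exhaust_2[of j] assms(1)
      by (auto simp: i d_def K_Delta_eig_def K_eig_def level_def x_def field_simps)
  qed
  have "of_real (d i) * coord (C v) i = coord (T v) i" for i
    using x_pos[of "level i"]
    by (simp add: C_coord T_coord d diag_weight_def off_weight_def field_simps)
  then show "C v \<in> diag_dom d" "diag_op d (C v) = T v"
    using diag_op_eqI[of d "C v" "T v"] by auto
qed

theorem proposition5:
  fixes q s :: real
  assumes "0 < q" and "q < 1" and "0 < s" and "s \<le> 1"
  defines "P \<equiv> podles_P q s"
  defines "\<pi>P \<equiv> podles_rep_mat q s P"
  shows "podles_is_projection q s P \<and>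
    commutes_with_diag (K_Delta_eig q) \<pi>P \<and>
    chern2_well_defined (K_Delta_eig q) (tensor_id gamma_op) (tensor_id F_op) \<pi>P \<pi>P \<pi>P \<and>
    chern2 (K_Delta_eig q) (tensor_id gamma_op) (tensor_id F_op) \<pi>P \<pi>P \<pi>P = of_real q"
proof -
  interpret podles_difference q "1 / s + s ^ 3" "podles_b q s"
    by (rule podles_difference[OF assms(1-3)])
  note chern = podles_chern_T[OF assms(1-3), folded P_def, folded \<pi>P_def]
  \<comment> \<open>The composite equals \<open>T\<close> everywhere, so trace class and trace carry
    over; the prefactor \<open>-1/2\<close> turns \<open>-2 q\<close> into \<open>q\<close>.\<close>
  have eq: "diag_op (K_Delta_eig q) \<circ>
      chern_bounded_part (tensor_id gamma_op) (tensor_id F_op) \<pi>P \<pi>P \<pi>P = T"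
    by (rule ext) (simp add: chern(2))
  show ?thesis
    unfolding chern2_well_defined_def chern2_def eq chern_lambda2_def
    using podles_projection[of q s] podles_commutes[OF assms(1,2), of s] assms(1) chern(1)
    by (auto simp: P_def \<pi>P_def trace_class_T trace_T)
qed

end
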